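(* Let $u$ and $v$ be two positive integers, let $m \neq \pm 1$ be a square free rational integer, and let $F(x) = x^{2^u\cdot 3^v}-m$, a monic irreducible polynomial over $\mathbb{Q}$. Let $\alpha$ be a complex root of $F(x)$, let $K=\mathbb{Q}(\alpha)$, and let $\mathbb{Z}_K$ be the ring of integers of $K$. Then $\mathbb{Z}[\alpha]=\mathbb{Z}_K$ if and only if $m\not\equiv 1 \pmod 4$ and $m\not\equiv \pm 1 \pmod 9$.
   Context: "$m\not\equiv \pm 1 \pmod 9$" means that $m\not\equiv 1 \pmod 9$ and $m\not\equiv -1\pmod 9$. *)

theory Defs
  imports
    "HOL-Computational_Algebra.Computational_Algebra"
    "HOL-Number_Theory.Cong"
    "HOL-Algebra.Algebraic_Closure_Type"
    "HOL-Algebra.Generated_Rings"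
    "HOL-Algebra.Generated_Fields"
begin

abbreviation complex_ring :: "complex ring" where
  "complex_ring \<equiv> ring_of_type_algebra"

text \<open>
  The smallest subfield of the complex numbers containing \<open>\<alpha>\<close>. In characteristic 0 every
  subfield contains the rationals, so they need not be listed among the generators; the same
  holds for the integers in \<open>int_adjoin\<close>.
\<close>

definition rat_adjoin :: "complex \<Rightarrow> complex set" where
  "rat_adjoin \<alpha> = generate_field complex_ring {\<alpha>}"

definition int_adjoin :: "complex \<Rightarrow> complex set" where
  "int_adjoin \<alpha> = generate_ring complex_ring {\<alpha>}"

definition ring_of_integers :: "complex set \<Rightarrow> complex set" where
  "ring_of_integers K = {x \<in> K. algebraic_int x}"

end

theory Submission
  imports Defs "Jordan_Normal_Form.Char_Poly"
begin

text \<open>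
  Put \<open>n = 2\<^sup>u 3\<^sup>v\<close>. Traces against powers of \<open>\<alpha>\<close> show that \<open>n m x \<in> \<int>[\<alpha>]\<close> for every integral
  \<open>x \<in> \<rat>(\<alpha>)\<close>, so it suffices to show that \<open>p x \<in> \<int>[\<alpha>]\<close> implies \<open>x \<in> \<int>[\<alpha>]\<close> for the
  primes \<open>p\<close> dividing \<open>m\<close>, and for \<open>2\<close> and \<open>3\<close>. Write \<open>p x\<close> in base \<open>\<pi>\<close>, where \<open>\<pi> = \<alpha>\<close> if \<open>p\<close> divides
  \<open>m\<close>, and \<open>\<pi> = \<alpha>\<^sup>a - m\<close> if \<open>n = p\<^sup>e a\<close> with \<open>a\<close> prime to \<open>p\<close>. Squarefreeness and the congruence conditions say that
  \<open>\<pi>\<close> behaves like a uniformizer at \<open>p\<close>, and then all digits are divisible by \<open>p\<close>. Conversely, if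
  they fail, \<open>(1 + \<surd>m) / 2\<close> or \<open>(1 \<plusminus> \<delta> + \<delta>\<^sup>2) / 3\<close> with \<open>\<delta>\<^sup>3 = m\<close> is an integral element outside
  \<open>\<int>[\<alpha>]\<close>.
\<close>

subsection \<open>Closure of the algebraic integers\<close>

text \<open>The hypothesis makes \<open>v\<close> an eigenvector, with eigenvalue \<open>x\<close>,
  of an integer matrix, so \<open>x\<close> is a root of its monic integer characteristic
  polynomial. An arbitrary index set allows indexing by pairs of exponents later.\<close>

lemma algebraic_int_if_int_eigen:
  fixes x :: complex and v :: "'i \<Rightarrow> complex"
  assumes "finite I" "k \<in> I" "v k \<noteq> 0"
    and "\<And>i. i \<in> I \<Longrightarrow> \<exists>c. x * v i = (\<Sum>j\<in>I. of_int (c j) * v j)"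
  shows "algebraic_int x"
proof -
  obtain C where C: "\<And>i. i \<in> I \<Longrightarrow> x * v i = (\<Sum>j\<in>I. of_int (C i j) * v j)"
    using assms(4) by metis
  obtain h where h: "bij_betw h {..<card I} I"
    using ex_bij_betw_nat_finite[OF assms(1)] by (auto simp: lessThan_atLeast0)
  define N where "N = card I"
  define A :: "int mat" where "A = mat N N (\<lambda>(i, j). C (h i) (h j))"
  define w where "w = vec N (\<lambda>i. v (h i))"
  have A: "A \<in> carrier_mat N N" by (simp add: A_def)
  have h_in: "h i \<in> I" if "i < N" for i
    using h that by (auto simp: bij_betw_def N_def)
  have "map_mat complex_of_int A *\<^sub>v w = x \<cdot>\<^sub>v w"
  proof (rule eq_vecI)
    fix i assume "i < dim_vec (x \<cdot>\<^sub>v w)"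
    then have i: "i < N" by (simp add: w_def)
    have "(map_mat complex_of_int A *\<^sub>v w) $ i = (\<Sum>j<N. of_int (C (h i) (h j)) * v (h j))"
      using i by (simp add: A_def w_def scalar_prod_def lessThan_atLeast0)
    also have "\<dots> = (\<Sum>j\<in>I. of_int (C (h i) j) * v j)"
      unfolding N_def by (rule sum.reindex_bij_betw[OF h])
    also have "\<dots> = x * v (h i)"
      using C[OF h_in[OF i]] by simp
    finally show "(map_mat complex_of_int A *\<^sub>v w) $ i = (x \<cdot>\<^sub>v w) $ i"
      using i by (simp add: w_def)
  qed (simp add: A_def w_def)
  moreover have "w \<noteq> 0\<^sub>v N"
  proof -
    obtain i where "i < N" "h i = k"
      using h assms(2) by (force simp: bij_betw_def N_def)
    then show ?thesis
      using assms(3) by (metis index_vec index_zero_vec(1) w_def)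
  qed
  ultimately have "eigenvalue (map_mat complex_of_int A) x"
    using A unfolding eigenvalue_def eigenvector_def by (intro exI[of _ w]) (auto simp: w_def)
  then have "poly (char_poly (map_mat complex_of_int A)) x = 0"
    using A by (subst (asm) eigenvalue_root_char_poly) auto
  then show ?thesis
    unfolding algebraic_int_altdef_ipoly of_int_hom.char_poly_hom[OF A]
    using degree_monic_char_poly[OF A] by auto
qed

section \<open>Integer spans of families of complex numbers\<close>

definition int_span :: "('i \<Rightarrow> complex) \<Rightarrow> 'i set \<Rightarrow> complex set" where
  "int_span v I = range (\<lambda>c. \<Sum>i\<in>I. of_int (c i) * v i)"

lemma int_spanI: "x = (\<Sum>i\<in>I. of_int (c i) * v i) \<Longrightarrow> x \<in> int_span v I"
  unfolding int_span_def by (rule image_eqI) simp_all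

lemma int_span_add:
  assumes "x \<in> int_span v I" "y \<in> int_span v I"
  shows "x + y \<in> int_span v I"
proof -
  obtain c d where "x = (\<Sum>i\<in>I. of_int (c i) * v i)" "y = (\<Sum>i\<in>I. of_int (d i) * v i)"
    using assms unfolding int_span_def by blast
  then have "x + y = (\<Sum>i\<in>I. of_int (c i + d i) * v i)"
    by (simp add: distrib_right sum.distrib)
  then show ?thesis by (rule int_spanI)
qed

lemma int_span_scale:
  assumes "x \<in> int_span v I"
  shows "of_int k * x \<in> int_span v I"
proof -
  obtain c where "x = (\<Sum>i\<in>I. of_int (c i) * v i)"
    using assms unfolding int_span_def by blast
  then have "of_int k * x = (\<Sum>i\<in>I. of_int (k * c i) * v i)"
    by (simp add: sum_distrib_left mult_ac)
  then show ?thesis by (rule int_spanI)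
qed

lemma int_span_0: "0 \<in> int_span v I"
proof -
  have "0 = (\<Sum>i\<in>I. of_int 0 * v i)" by simp
  then show ?thesis by (rule int_spanI)
qed

lemma int_span_sum:
  "(\<And>j. j \<in> J \<Longrightarrow> f j \<in> int_span v I) \<Longrightarrow> (\<Sum>j\<in>J. of_int (c j) * f j) \<in> int_span v I"
  by (induction J rule: infinite_finite_induct) (auto intro: int_span_add int_span_scale int_span_0)

lemma int_span_base:
  assumes "finite I" "i \<in> I"
  shows "v i \<in> int_span v I"
proof -
  have "(\<Sum>j\<in>I. of_int (if j = i then 1 else 0) * v j) = (\<Sum>j\<in>I. if j = i then v j else 0)"
    by (intro sum.cong) auto
  also have "\<dots> = v i" using assms by simp
  finally have "v i = (\<Sum>j\<in>I. of_int (if j = i then 1 else 0) * v j)" ..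
  then show ?thesis by (rule int_spanI)
qed

text \<open>Solving the monic equation for its leading power lets \<open>x ^ k\<close> be rewritten
  by lower powers, which makes their span stable under multiplication by \<open>x\<close>.\<close>

lemma algebraic_intE_power:
  fixes x :: complex
  assumes "algebraic_int x"
  obtains k c where "k > 0" "x ^ k = (\<Sum>i<k. of_int (c i) * x ^ i)"
proof -
  obtain p where p: "poly (map_poly of_int p) x = 0" "lead_coeff p = 1"
    using assms by (auto simp: algebraic_int_altdef_ipoly)
  have deg: "degree p > 0"
    using p by (auto intro!: gr0I elim!: degree_eq_zeroE)
  have "0 = (\<Sum>i\<le>degree p. of_int (coeff p i) * x ^ i)"
    using p(1) by (simp add: poly_altdef degree_map_poly coeff_map_poly)
  also have "\<dots> = (\<Sum>i<degree p. of_int (coeff p i) * x ^ i) + x ^ degree p"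
    using p(2) by (simp flip: lessThan_Suc_atMost)
  finally have "x ^ degree p = - (\<Sum>i<degree p. of_int (coeff p i) * x ^ i)"
    by (simp only: eq_neg_iff_add_eq_0 add.commute [of "x ^ _"])
  also have "\<dots> = (\<Sum>i<degree p. of_int (- coeff p i) * x ^ i)"
    unfolding sum_negf [symmetric] by (intro sum.cong) auto
  finally show ?thesis using that[OF deg, of "\<lambda>i. - coeff p i"] by fast
qed

text \<open>The monomials \<open>x ^ i * y ^ j\<close> with \<open>i < k\<close> and
  \<open>j < l\<close> span a module stable under multiplication by \<open>x\<close> and
  \<open>y\<close>, hence by \<open>x + y\<close> and \<open>x * y\<close>; the eigenvalue criterion
  applies, with the monomial 1 as nonzero entry.\<close>

lemma algebraic_int_plus_times:
  fixes x y :: complex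
  assumes "algebraic_int x" "algebraic_int y"
  shows "algebraic_int (x + y)" "algebraic_int (x * y)"
proof -
  obtain k c where k: "k > 0" "x ^ k = (\<Sum>i<k. of_int (c i) * x ^ i)"
    using assms(1) by (rule algebraic_intE_power)
  obtain l d where l: "l > 0" "y ^ l = (\<Sum>i<l. of_int (d i) * y ^ i)"
    using assms(2) by (rule algebraic_intE_power)
  define I where "I = {..<k} \<times> {..<l}"
  define v where "v = (\<lambda>(i, j). x ^ i * y ^ j)"
  have fin: "finite I" by (simp add: I_def)
  have base: "x ^ i * y ^ j \<in> int_span v I" if "i < k" "j < l" for i j
    using int_span_base[OF fin, of "(i, j)" v] that by (simp add: I_def v_def)
  have x_base: "x * (x ^ i * y ^ j) \<in> int_span v I" if "i < k" "j < l" for i j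
  proof (cases "Suc i = k")
    case True
    have "x * (x ^ i * y ^ j) = x ^ k * y ^ j"
      by (simp flip: True)
    also have "\<dots> = (\<Sum>i<k. of_int (c i) * (x ^ i * y ^ j))"
      unfolding k(2) sum_distrib_right by (simp add: mult_ac)
    also have "\<dots> \<in> int_span v I"
      by (intro int_span_sum base) (use that in auto)
    finally show ?thesis .
  next
    case False
    then show ?thesis using base[of "Suc i" j] that by (simp add: mult_ac)
  qed
  have y_base: "y * (x ^ i * y ^ j) \<in> int_span v I" if "i < k" "j < l" for i j
  proof (cases "Suc j = l")
    case True
    have "y * (x ^ i * y ^ j) = x ^ i * y ^ l"
      by (simp flip: True)
    also have "\<dots> = (\<Sum>j<l. of_int (d j) * (x ^ i * y ^ j))"
      unfolding l(2) sum_distrib_left by (simp add: mult_ac)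
    also have "\<dots> \<in> int_span v I"
      by (intro int_span_sum base) (use that in auto)
    finally show ?thesis .
  next
    case False
    then show ?thesis using base[of i "Suc j"] that by (simp add: mult_ac)
  qed
  have xy_v: "x * v e \<in> int_span v I \<and> y * v e \<in> int_span v I" if "e \<in> I" for e
  proof -
    obtain i j where e: "e = (i, j)" by (cases e)
    then have "i < k" "j < l" using that by (auto simp: I_def)
    moreover have "v e = x ^ i * y ^ j" by (simp add: e v_def)
    ultimately show ?thesis using x_base y_base by simp
  qed
  \<comment> \<open>For the product, \<open>x\<close> acts on \<open>y * v i\<close>, which is only
    a combination of monomials.\<close>
  have x_span: "x * z \<in> int_span v I" if z: "z \<in> int_span v I" for z
  proof -
    obtain e where e: "z = (\<Sum>i\<in>I. of_int (e i) * v i)"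
      using z by (auto simp: int_span_def)
    have "x * z = (\<Sum>i\<in>I. of_int (e i) * (x * v i))"
      unfolding e sum_distrib_left by (simp add: mult_ac)
    also have "\<dots> \<in> int_span v I"
      using xy_v by (intro int_span_sum) blast
    finally show ?thesis .
  qed
  have algebraic: "algebraic_int z" if "\<And>i. i \<in> I \<Longrightarrow> z * v i \<in> int_span v I" for z
  proof (rule algebraic_int_if_int_eigen[OF fin])
    show "(0, 0) \<in> I" "v (0, 0) \<noteq> 0"
      using k l by (auto simp: I_def v_def)
  qed (use that in \<open>auto simp: int_span_def\<close>)
  show "algebraic_int (x + y)"
    using xy_v by (intro algebraic) (simp add: distrib_right int_span_add)
  show "algebraic_int (x * y)"
    using xy_v x_span by (intro algebraic) (simp add: mult.assoc)
qed

lemma algebraic_int_diff: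
  "algebraic_int (x :: complex) \<Longrightarrow> algebraic_int y \<Longrightarrow> algebraic_int (x - y)"
  using algebraic_int_plus_times(1)[of x "- y"] by auto

lemma algebraic_int_power: "algebraic_int (x :: complex) \<Longrightarrow> algebraic_int (x ^ k)"
  by (induction k) (auto intro: algebraic_int_plus_times)

lemma algebraic_int_sum:
  "(\<And>i. i \<in> I \<Longrightarrow> algebraic_int (f i :: complex)) \<Longrightarrow> algebraic_int (\<Sum>i\<in>I. f i)"
  by (induction I rule: infinite_finite_induct) (auto intro: algebraic_int_plus_times)

lemma prod_mset_power:
  fixes f :: "'b \<Rightarrow> 'a :: comm_semiring_1"
  shows "(\<Prod>x\<in>#A. f x) ^ n = (\<Prod>x\<in>#A. f x ^ n)"
  by (induction A) (simp_all add: power_mult_distrib)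

lemma algebraic_int_if_power:
  fixes x :: "'a :: field_char_0"
  assumes "x ^ n = of_int k" "n > 0"
  shows "algebraic_int x"
  by (rule algebraic_int_root[where p = "monom 1 n" and y = "of_int k"])
    (use assms in \<open>auto simp: poly_monom degree_monom_eq\<close>)

subsection \<open>Pure radical extensions\<close>

abbreviation rat_eval :: "rat poly \<Rightarrow> complex \<Rightarrow> complex" where
  "rat_eval P x \<equiv> poly (map_poly of_rat P) x"

interpretation of_rat_poly_hom: map_poly_comm_ring_hom "of_rat :: rat \<Rightarrow> complex" ..

lemma rat_eval_add: "rat_eval (P + Q) x = rat_eval P x + rat_eval Q x"
  by (simp add: of_rat_poly_hom.hom_add)

lemma rat_eval_diff: "rat_eval (P - Q) x = rat_eval P x - rat_eval Q x"
  by (simp add: of_rat_poly_hom.hom_minus)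

lemma rat_eval_mult: "rat_eval (P * Q) x = rat_eval P x * rat_eval Q x"
  by (simp add: of_rat_poly_hom.hom_mult)

lemma rat_eval_altdef: "rat_eval P x = (\<Sum>i\<le>degree P. of_rat (coeff P i) * x ^ i)"
  by (simp add: poly_altdef)

lemma rat_eval_altdef_lessThan:
  assumes "degree P < n"
  shows "rat_eval P x = (\<Sum>i<n. of_rat (coeff P i) * x ^ i)"
  unfolding rat_eval_altdef
  by (rule sum.mono_neutral_left) (use assms in \<open>auto simp: coeff_eq_0\<close>)

lemma rat_eval_const: "rat_eval [:c:] x = of_rat c"
  by (simp add: rat_eval_altdef)

text \<open>The exponent is left general because the locale is interpreted twice: for \<alpha>
  itself and, in the proof at a prime dividing the degree, for \<open>\<alpha> ^ q\<close> with
  exponent \<open>a\<close>.\<close>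

locale pure_radical =
  fixes n :: nat and m :: int and \<alpha> :: complex
  assumes n_pos: "n > 0" and sqfree: "squarefree m" and m_neq: "m \<noteq> 1" "m \<noteq> - 1"
    and root: "\<alpha> ^ n = of_int m"
begin

definition F :: "rat poly" where "F = monom 1 n - [:of_int m:]"

lemma m_nonzero: "m \<noteq> 0"
  using sqfree by auto

lemma alpha_algebraic_int: "algebraic_int \<alpha>"
  using root n_pos by (rule algebraic_int_if_power)

lemma prime_exactly_dvd: obtains p :: int where "Factorial_Ring.prime p" "multiplicity p m = 1"
proof -
  have "\<not> is_unit m" using m_neq by auto
  then obtain p where p: "Factorial_Ring.prime p" "p dvd m"
    using m_nonzero prime_divisor_exists by blast
  then have "\<not> p ^ 2 dvd m"
    using sqfree not_prime_unit by (auto simp: squarefree_def)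
  then have "multiplicity p m = 1"
    using p by (intro multiplicity_eqI) (auto simp: power2_eq_square)
  then show ?thesis using that p by blast
qed

lemma F_eval: "rat_eval F x = x ^ n - of_int m"
  by (simp only: F_def rat_eval_diff rat_eval_const) (simp add: map_poly_monom poly_monom)

lemma F_degree: "degree F = n"
  unfolding F_def using n_pos
  unfolding diff_conv_add_uminus
  by (subst degree_add_eq_left) (simp_all add: degree_monom_eq)

lemma F_lead_coeff: "lead_coeff F = 1"
  unfolding F_degree using n_pos by (simp add: F_def coeff_pCons split: nat.split)

lemma F_nonzero: "F \<noteq> 0"
  using F_lead_coeff by force

text \<open>The constant coefficient \<open>z\<close> of a monic factor of degree \<open>k\<close> is up to sign a product of
  \<open>k\<close> roots, so \<open>z\<^sup>n = \<plusminus>m\<^sup>k\<close>; comparing multiplicities of a prime divisor of \<open>m\<close> yields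
  \<open>n dvd k\<close>.\<close>
lemma F_factor_degree:
  assumes "a dvd F"
  shows "n dvd degree a"
proof -
  have a0: "a \<noteq> 0" using assms F_nonzero by auto
  obtain A where A: "size A = degree a"
      "map_poly complex_of_rat a = smult (of_rat (lead_coeff a)) (\<Prod>x\<in>#A. [:-x, 1:])"
    using alg_closed_imp_factorization[of "map_poly complex_of_rat a"] a0 by auto
  have roots: "x ^ n = of_int m" if "x \<in># A" for x
  proof -
    have "rat_eval a x = 0"
      using that by (auto simp: A(2) poly_prod_mset prod_mset_zero_iff)
    then have "rat_eval F x = 0"
      using assms by (auto simp: rat_eval_mult)
    then show ?thesis by (simp add: F_eval)
  qed
  define c where "c = coeff a 0 / lead_coeff a"
  have "of_rat (coeff a 0) = rat_eval a 0"
    by (simp add: poly_0_coeff_0)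
  also have "\<dots> = of_rat (lead_coeff a) * (\<Prod>x\<in>#A. - x)"
    by (simp add: A(2) poly_prod_mset)
  finally have "of_rat c = (\<Prod>x\<in>#A. - x)"
    using a0 by (simp add: c_def of_rat_divide)
  moreover have "(\<Prod>x\<in>#A. - x) ^ n = (\<Prod>x\<in>#A. (- x) ^ n)"
    by (rule prod_mset_power)
  ultimately have "of_rat c ^ n = (\<Prod>x\<in>#A. (- x) ^ n)"
    by simp
  also have "\<dots> = (\<Prod>x\<in>#A. (- 1) ^ n * of_int m)"
    using roots by (intro arg_cong[of _ _ prod_mset] image_mset_cong) (metis power_minus)
  also have "\<dots> = of_rat (of_int (((- 1) ^ n * m) ^ degree a))"
    by (simp only: of_rat_of_int_eq) (simp add: A(1))
  finally have c: "c ^ n = of_int (((- 1) ^ n * m) ^ degree a)"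
    by (simp only: of_rat_power [symmetric] of_rat_eq_iff)
  \<comment> \<open>A rational number with an integral power is an algebraic integer, hence an
    integer \<open>z\<close>.\<close>
  then have "algebraic_int c" using n_pos by (rule algebraic_int_if_power)
  then obtain z where "c = of_int z"
    using rational_algebraic_int_is_int[of c] by (auto simp: Ints_def Rats_def)
  then have z: "z ^ n = ((- 1) ^ n * m) ^ degree a"
    using c by (simp only: of_int_power [symmetric] of_int_eq_iff)
  obtain p :: int where p: "Factorial_Ring.prime p" "multiplicity p m = 1"
    by (rule prime_exactly_dvd)
  have "z \<noteq> 0"
    using z n_pos m_nonzero by (auto simp: power_0_left)
  then have "multiplicity p (z ^ n) = n * multiplicity p z"
    using p by (intro prime_elem_multiplicity_power_distrib) auto
  moreover have "multiplicity p (((- 1) ^ n * m) ^ degree a) = degree a * multiplicity p ((- 1) ^ n * m)"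
    using p m_nonzero by (intro prime_elem_multiplicity_power_distrib) auto
  moreover have "multiplicity p ((- 1) ^ n * m) = 1"
    using p by (subst multiplicity_times_unit_right) (auto simp: is_unit_power_iff)
  ultimately show ?thesis using z by (metis dvd_triv_left mult.right_neutral)
qed

text \<open>The degree of a factor is a multiple of \<open>n\<close> that is at most
  \<open>n\<close>, so one factor of any product is constant.\<close>

lemma F_irreducible: "Factorial_Ring.irreducible F"
proof (rule comm_semiring_1_class.irreducibleI)
  show "F \<noteq> 0" by (rule F_nonzero)
  show "\<not> is_unit F" using F_degree n_pos by (auto simp: is_unit_iff_degree F_nonzero)
next
  fix a b assume ab: "F = a * b"
  then have nz: "a \<noteq> 0" "b \<noteq> 0" using F_nonzero by auto
  have "n dvd degree a" using ab by (intro F_factor_degree) auto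
  moreover have "n = degree a + degree b"
    using F_degree ab nz by (simp add: degree_mult_eq)
  ultimately have "degree a = 0 \<or> degree b = 0"
    by (metis dvd_imp_le le_antisym le_add1 add_cancel_right_right neq0_conv)
  then show "is_unit a \<or> is_unit b" using nz by (simp add: is_unit_iff_degree)
qed

text \<open>Evaluating a Bezout identity for the coprime pair \<open>F\<close>, \<open>P\<close> at
  \<alpha> kills the term with \<open>F\<close>. This gives both the minimality of \<open>F\<close>
  and inverses in \<rat>(\<alpha>).\<close>

lemma bezout_F:
  assumes "\<not> F dvd P"
  obtains Q where "rat_eval Q \<alpha> * rat_eval P \<alpha> = 1"
proof -
  have "coprime F P"
    using F_irreducible assms by (intro prime_elem_imp_coprime irreducible_imp_prime_elem)
  then obtain R Q where "R * F + Q * P = 1"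
    by (metis bezout_coefficients_fst_snd coprime_imp_gcd_eq_1)
  then have "rat_eval (R * F + Q * P) \<alpha> = 1" by simp
  then show ?thesis
    using that[of Q] by (simp add: rat_eval_add rat_eval_mult F_eval root)
qed

lemma F_dvd_if_root:
  assumes "rat_eval P \<alpha> = 0"
  shows "F dvd P"
  using bezout_F assms by fastforce

section \<open>Conjugates and traces\<close>

lemma conjugate_root:
  assumes "rat_eval P \<alpha> = 0" "x ^ n = of_int m"
  shows "rat_eval P x = 0"
  using F_dvd_if_root[OF assms(1)] assms(2) by (auto simp: rat_eval_mult F_eval)

text \<open>If the monic integer polynomial \<open>Q\<close> kills \<open>B(\<alpha>)\<close>, then
  the composition \<open>Q(B)\<close> vanishes at \<alpha>, hence at every root \<open>x\<close> of
  \<open>F\<close>.\<close>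

lemma conjugate_algebraic_int:
  assumes "algebraic_int (rat_eval B \<alpha>)" "x ^ n = of_int m"
  shows "algebraic_int (rat_eval B x)"
proof -
  obtain Q where Q: "poly (map_poly of_int Q) (rat_eval B \<alpha>) = 0" "lead_coeff Q = 1"
    using assms(1) by (auto simp: algebraic_int_altdef_ipoly)
  have eval: "rat_eval (pcompose (map_poly of_int Q) B) y = poly (map_poly of_int Q) (rat_eval B y)" for y
    by (simp add: of_rat_hom.map_poly_pcompose poly_pcompose map_poly_map_poly o_def)
  have "rat_eval (pcompose (map_poly of_int Q) B) x = 0"
    by (rule conjugate_root) (use Q(1) assms(2) eval in simp_all)
  then show ?thesis
    using Q(2) by (auto simp: algebraic_int_altdef_ipoly eval)
qed

lemma sum_roots_unity_power:
  assumes "0 < k" "k < n"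
  shows "(\<Sum>j<n. (cis (2 * pi / n) ^ k) ^ j) = 0"
proof -
  define w where "w = cis (2 * pi / n) ^ k"
  have w: "w = cis (2 * pi * k / n)"
    by (simp add: w_def DeMoivre mult_ac)
  have "inj_on (\<lambda>k. cis (2 * pi * real k / real n)) {..<n}"
    using bij_betw_roots_unity[OF n_pos] by (rule bij_betw_imp_inj_on)
  then have "w \<noteq> 1"
    using inj_onD[of _ "{..<n}" k 0] assms by (force simp: w)
  moreover have "w ^ n = 1"
    using n_pos by (simp add: w DeMoivre cis_multiple_2pi)
  ultimately show ?thesis
    by (simp add: w_def [symmetric] sum_gp_strict)
qed

text \<open>The trace of \<open>B(\<alpha>) \<alpha>\<^sup>n\<^sup>-\<^sup>i\<close>, taken as the sum over the conjugates
  \<open>\<zeta>\<^sup>j \<alpha>\<close>, picks out the \<open>i\<close>-th coefficient of \<open>B\<close>.\<close>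
lemma coeff_algebraic_int:
  assumes int: "algebraic_int (rat_eval B \<alpha>)" and deg: "degree B < n" and i: "i < n"
  shows "of_nat n * of_int m * coeff B i \<in> \<int>"
proof -
  define \<zeta> where "\<zeta> = cis (2 * pi / n)"
  have zeta: "\<zeta> ^ n = 1"
    using n_pos by (simp add: \<zeta>_def DeMoivre)
  define x where "x = (\<lambda>j. \<zeta> ^ j * \<alpha>)"
  have x: "x j ^ n = of_int m" for j
    by (simp add: x_def power_mult_distrib root flip: power_mult)
      (simp add: mult.commute[of j] power_mult zeta)
  \<comment> \<open>The exponent \<open>k + n - i\<close> stands for \<open>k - i\<close> modulo
    \<open>n\<close> without leaving the naturals; orthogonality leaves only
    \<open>k = i\<close>.\<close>
  have orth: "(\<Sum>j<n. (\<zeta> ^ (k + n - i)) ^ j) = (if k = i then of_nat n else 0)" if "k < n" for k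
  proof -
    consider "k = i" | "k < i" | "k > i" by linarith
    then show ?thesis
    proof cases
      case 1
      then show ?thesis by (simp add: zeta)
    next
      case 2
      then show ?thesis
        using i sum_roots_unity_power[of "k + n - i"] by (simp add: \<zeta>_def)
    next
      case 3
      then have "k + n - i = n + (k - i)" by simp
      then have "\<zeta> ^ (k + n - i) = \<zeta> ^ (k - i)"
        by (simp only: power_add zeta mult_1)
      then show ?thesis
        using 3 that sum_roots_unity_power[of "k - i"] by (simp add: \<zeta>_def)
    qed
  qed
  define S where "S = (\<Sum>j<n. rat_eval B (x j) * x j ^ (n - i))"
  have "algebraic_int S"
    unfolding S_def
    by (intro algebraic_int_sum algebraic_int_plus_times(2) conjugate_algebraic_int[OF int]
        algebraic_int_power algebraic_int_if_power[OF x] x n_pos)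
  have "S = (\<Sum>j<n. \<Sum>k<n. of_rat (coeff B k) * \<alpha> ^ (k + n - i) * (\<zeta> ^ (k + n - i)) ^ j)"
    unfolding S_def rat_eval_altdef_lessThan[OF deg] sum_distrib_right
  proof (intro sum.cong refl)
    fix j k
    have "x j ^ k * x j ^ (n - i) = x j ^ (k + n - i)"
      using i by (simp flip: power_add)
    also have "\<dots> = \<alpha> ^ (k + n - i) * (\<zeta> ^ (k + n - i)) ^ j"
      by (simp add: x_def power_mult_distrib mult.commute flip: power_mult)
    finally show "of_rat (coeff B k) * x j ^ k * x j ^ (n - i) =
        of_rat (coeff B k) * \<alpha> ^ (k + n - i) * (\<zeta> ^ (k + n - i)) ^ j"
      by (simp only: mult.assoc)
  qed
  also have "\<dots> = (\<Sum>k<n. of_rat (coeff B k) * \<alpha> ^ (k + n - i) * (\<Sum>j<n. (\<zeta> ^ (k + n - i)) ^ j))"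
    by (subst sum.swap) (simp only: sum_distrib_left)
  \<comment> \<open>In the surviving term \<open>\<alpha> ^ n\<close> equals \<open>m\<close>, which
    is the source of the factor \<open>m\<close> in the bound.\<close>
  also have "\<dots> = (\<Sum>k<n. if k = i then of_rat (coeff B i) * \<alpha> ^ n * of_nat n else 0)"
    by (intro sum.cong) (auto simp: orth)
  also have "\<dots> = of_rat (of_nat n * of_int m * coeff B i)"
    using i by (simp add: root of_rat_mult)
  finally have S: "S = of_rat (of_nat n * of_int m * coeff B i)" .
  then have "S \<in> \<int>"
    using \<open>algebraic_int S\<close> by (intro rational_algebraic_int_is_int) auto
  then obtain z where "S = of_int z" by (auto simp: Ints_def)
  then have "of_rat (of_nat n * of_int m * coeff B i) = (of_rat (of_int z) :: complex)"
    using S by simp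
  then show ?thesis by (simp only: of_rat_eq_iff) simp
qed

end

subsection \<open>The ring generated by an element\<close>

lemma complex_ring_simps:
  "carrier complex_ring = UNIV" "x \<otimes>\<^bsub>complex_ring\<^esub> y = x * y" "\<one>\<^bsub>complex_ring\<^esub> = 1"
  "x \<oplus>\<^bsub>complex_ring\<^esub> y = x + y" "\<zero>\<^bsub>complex_ring\<^esub> = 0"
  by (simp_all add: ring_of_type_algebra_def)

interpretation complex_ring: cring complex_ring
  by (rule cring_from_type_algebra)

lemma complex_ring_uminus: "\<ominus>\<^bsub>complex_ring\<^esub> x = - x"
  using complex_ring.minus_equality[of "- x" x] by (simp add: complex_ring_simps)

lemma complex_ring_inv: "x \<noteq> 0 \<Longrightarrow> inv\<^bsub>complex_ring\<^esub> x = inverse x"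
  using complex_ring.comm_inv_char[of x "inverse x"] by (simp add: complex_ring_simps)

lemma int_adjoin_gen: "\<alpha> \<in> int_adjoin \<alpha>"
  unfolding int_adjoin_def by (rule generate_ring.incl) simp

lemma int_adjoin_1: "1 \<in> int_adjoin \<alpha>"
  using generate_ring.one[of complex_ring "{\<alpha>}"] by (simp add: int_adjoin_def complex_ring_simps)

lemma int_adjoin_add: "x \<in> int_adjoin \<alpha> \<Longrightarrow> y \<in> int_adjoin \<alpha> \<Longrightarrow> x + y \<in> int_adjoin \<alpha>"
  using generate_ring.eng_add[of x complex_ring "{\<alpha>}" y] by (simp add: int_adjoin_def complex_ring_simps)

lemma int_adjoin_mult: "x \<in> int_adjoin \<alpha> \<Longrightarrow> y \<in> int_adjoin \<alpha> \<Longrightarrow> x * y \<in> int_adjoin \<alpha>"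
  using generate_ring.eng_mult[of x complex_ring "{\<alpha>}" y] by (simp add: int_adjoin_def complex_ring_simps)

lemma int_adjoin_uminus: "x \<in> int_adjoin \<alpha> \<Longrightarrow> - x \<in> int_adjoin \<alpha>"
  using generate_ring.a_inv[of x complex_ring "{\<alpha>}"] by (simp add: int_adjoin_def complex_ring_uminus)

lemma int_adjoin_diff: "x \<in> int_adjoin \<alpha> \<Longrightarrow> y \<in> int_adjoin \<alpha> \<Longrightarrow> x - y \<in> int_adjoin \<alpha>"
  using int_adjoin_add[of x \<alpha> "- y"] int_adjoin_uminus[of y] by simp

lemma int_adjoin_0: "0 \<in> int_adjoin \<alpha>"
  using int_adjoin_diff[OF int_adjoin_1 int_adjoin_1] by simp

lemma int_adjoin_of_nat: "of_nat k \<in> int_adjoin \<alpha>"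
  by (induction k) (auto intro: int_adjoin_0 int_adjoin_1 int_adjoin_add)

lemma int_adjoin_of_int: "of_int k \<in> int_adjoin \<alpha>"
  by (cases k) (auto intro: int_adjoin_of_nat int_adjoin_uminus simp del: of_nat_Suc)

lemma int_adjoin_power: "x \<in> int_adjoin \<alpha> \<Longrightarrow> x ^ k \<in> int_adjoin \<alpha>"
  by (induction k) (auto intro: int_adjoin_1 int_adjoin_mult)

lemma int_adjoin_sum:
  "(\<And>i. i \<in> I \<Longrightarrow> f i \<in> int_adjoin \<alpha>) \<Longrightarrow> (\<Sum>i\<in>I. f i) \<in> int_adjoin \<alpha>"
  by (induction I rule: infinite_finite_induct) (auto intro: int_adjoin_0 int_adjoin_add)

lemmas int_adjoin_closed = int_adjoin_gen int_adjoin_0 int_adjoin_1 int_adjoin_add int_adjoin_mult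
  int_adjoin_uminus int_adjoin_diff int_adjoin_of_nat int_adjoin_of_int int_adjoin_power int_adjoin_sum

lemma int_adjoin_induct [consumes 1, case_names gen one uminus add mult]:
  assumes "x \<in> int_adjoin \<alpha>"
    and "P \<alpha>" "P 1" "\<And>x. P x \<Longrightarrow> P (- x)"
    and "\<And>x y. P x \<Longrightarrow> P y \<Longrightarrow> P (x + y)" "\<And>x y. P x \<Longrightarrow> P y \<Longrightarrow> P (x * y)"
  shows "P x"
  using assms(1) unfolding int_adjoin_def
  by induction (use assms(2-) in \<open>auto simp: complex_ring_simps complex_ring_uminus\<close>)

lemma int_adjoin_algebraic_int:
  "x \<in> int_adjoin \<alpha> \<Longrightarrow> algebraic_int \<alpha> \<Longrightarrow> algebraic_int x"
  by (induction rule: int_adjoin_induct) (auto intro: algebraic_int_plus_times)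

text \<open>Every ring element maps the span into itself, by induction on its generation from
  \<alpha>; applied to 1 this gives the inclusion.\<close>

lemma int_adjoin_subset_int_span:
  assumes one: "1 \<in> int_span v I" and stable: "\<And>i. i \<in> I \<Longrightarrow> \<alpha> * v i \<in> int_span v I"
  shows "int_adjoin \<alpha> \<subseteq> int_span v I"
proof -
  have "x * z \<in> int_span v I" if "x \<in> int_adjoin \<alpha>" "z \<in> int_span v I" for x z
    using that
  proof (induction arbitrary: z rule: int_adjoin_induct)
    case gen
    then obtain c where c: "z = (\<Sum>i\<in>I. of_int (c i) * v i)"
      by (auto simp: int_span_def)
    have "\<alpha> * z = (\<Sum>i\<in>I. of_int (c i) * (\<alpha> * v i))"
      unfolding c sum_distrib_left by (simp add: mult_ac)
    also have "\<dots> \<in> int_span v I"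
      using stable by (rule int_span_sum)
    finally show ?case .
  next
    case (uminus x)
    then have "of_int (- 1) * (x * z) \<in> int_span v I"
      by (intro int_span_scale) auto
    then show ?case by simp
  qed (auto simp: distrib_right mult.assoc intro: int_span_add)
  from this[OF _ one] show ?thesis by auto
qed

section \<open>The field \<rat>(\<alpha>)\<close>

lemma rat_adjoin_gen: "\<alpha> \<in> rat_adjoin \<alpha>"
  unfolding rat_adjoin_def by (rule generate_field.incl) simp

lemma rat_adjoin_add: "x \<in> rat_adjoin \<alpha> \<Longrightarrow> y \<in> rat_adjoin \<alpha> \<Longrightarrow> x + y \<in> rat_adjoin \<alpha>"
  using generate_field.eng_add[of x complex_ring "{\<alpha>}" y] by (simp add: rat_adjoin_def complex_ring_simps)

lemma rat_adjoin_mult: "x \<in> rat_adjoin \<alpha> \<Longrightarrow> y \<in> rat_adjoin \<alpha> \<Longrightarrow> x * y \<in> rat_adjoin \<alpha>"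
  using generate_field.eng_mult[of x complex_ring "{\<alpha>}" y] by (simp add: rat_adjoin_def complex_ring_simps)

lemma rat_adjoin_inverse: "x \<in> rat_adjoin \<alpha> \<Longrightarrow> x \<noteq> 0 \<Longrightarrow> inverse x \<in> rat_adjoin \<alpha>"
  using generate_field.m_inv[of x complex_ring "{\<alpha>}"]
  by (simp add: rat_adjoin_def complex_ring_simps complex_ring_inv)

lemma rat_adjoin_divide:
  "x \<in> rat_adjoin \<alpha> \<Longrightarrow> y \<in> rat_adjoin \<alpha> \<Longrightarrow> y \<noteq> 0 \<Longrightarrow> x / y \<in> rat_adjoin \<alpha>"
  unfolding divide_inverse by (intro rat_adjoin_mult rat_adjoin_inverse)

lemma rat_adjoin_1: "1 \<in> rat_adjoin \<alpha>"
  using generate_field.one[of complex_ring "{\<alpha>}"] by (simp add: rat_adjoin_def complex_ring_simps)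

lemma rat_adjoin_uminus: "x \<in> rat_adjoin \<alpha> \<Longrightarrow> - x \<in> rat_adjoin \<alpha>"
  using generate_field.a_inv[of x complex_ring "{\<alpha>}"] by (simp add: rat_adjoin_def complex_ring_uminus)

lemma int_adjoin_subset_rat_adjoin: "x \<in> int_adjoin \<alpha> \<Longrightarrow> x \<in> rat_adjoin \<alpha>"
  by (induction rule: int_adjoin_induct)
    (auto intro: rat_adjoin_gen rat_adjoin_1 rat_adjoin_uminus rat_adjoin_add rat_adjoin_mult)

section \<open>Powers with prime power exponent modulo \<open>p\<close>\<close>

text \<open>From \<open>k * (q choose k) = q * (q - 1 choose (k - 1))\<close> with
  \<open>q = p ^ e\<close>: were the binomial prime to \<open>p\<close>, then \<open>q\<close> would
  divide the smaller number \<open>k\<close>.\<close>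

lemma prime_dvd_binomial_prime_power:
  fixes p :: nat
  assumes "Factorial_Ring.prime p" "0 < k" "k < p ^ e"
  shows "p dvd p ^ e choose k"
proof (rule ccontr)
  assume "\<not> p dvd p ^ e choose k"
  then have "coprime (p ^ e) (p ^ e choose k)"
    using assms(1) by (simp add: prime_imp_coprime)
  moreover have "p ^ e dvd k * (p ^ e choose k)"
    using times_binomial_minus1_eq[OF assms(2), of "p ^ e"] by simp
  ultimately have "p ^ e dvd k"
    by (simp add: coprime_dvd_mult_left_iff)
  then show False using assms by (auto dest: dvd_imp_le)
qed

text \<open>The inner terms of the binomial expansion are divisible by \<open>p\<close>,
  \<open>x\<close> and \<open>y\<close>. The factor \<open>x\<close> is kept explicit because a
  later application needs a correction term divisible by \<open>\<pi>\<close>.\<close>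

lemma int_adjoin_prime_power_add:
  fixes p :: nat
  assumes p: "Factorial_Ring.prime p" and x: "x \<in> int_adjoin \<alpha>" and y: "y \<in> int_adjoin \<alpha>"
  obtains w where "w \<in> int_adjoin \<alpha>"
    "(x + y) ^ p ^ e = x ^ p ^ e + y ^ p ^ e + of_nat p * x * y * w"
proof -
  define q where "q = p ^ e"
  have q: "q > 0" using p by (simp add: q_def prime_gt_0_nat)
  define w where "w = (\<Sum>k\<in>{0<..<q}. of_nat ((q choose k) div p) * x ^ (k - 1) * y ^ (q - k - 1))"
  have "(x + y) ^ q = (\<Sum>k\<in>insert 0 (insert q {0<..<q}). of_nat (q choose k) * x ^ k * y ^ (q - k))"
    unfolding binomial_ring by (rule sum.cong) auto
  also have "\<dots> = x ^ q + y ^ q + (\<Sum>k\<in>{0<..<q}. of_nat (q choose k) * x ^ k * y ^ (q - k))"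
    using q by simp
  also have "(\<Sum>k\<in>{0<..<q}. of_nat (q choose k) * x ^ k * y ^ (q - k)) = of_nat p * x * y * w"
    unfolding w_def sum_distrib_left
  proof (rule sum.cong)
    fix k assume k: "k \<in> {0<..<q}"
    then have "q choose k = p * ((q choose k) div p)"
      using prime_dvd_binomial_prime_power[OF p, of k e] by (simp add: q_def)
    then have "(of_nat (q choose k) :: complex) = of_nat p * of_nat ((q choose k) div p)"
      by (metis of_nat_mult)
    moreover have "x ^ k = x * x ^ (k - 1)" "y ^ (q - k) = y * y ^ (q - k - 1)"
      using k power_eq_if[of x k] power_eq_if[of y "q - k"] by auto
    ultimately show "of_nat (q choose k) * x ^ k * y ^ (q - k) =
        of_nat p * x * y * (of_nat ((q choose k) div p) * x ^ (k - 1) * y ^ (q - k - 1))"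
      by (simp only: mult_ac)
  qed simp
  finally have "(x + y) ^ q = x ^ q + y ^ q + of_nat p * x * y * w" .
  moreover have "w \<in> int_adjoin \<alpha>"
    unfolding w_def by (intro int_adjoin_closed x y)
  ultimately show ?thesis using that by (simp add: q_def)
qed

lemma int_adjoin_prime_power_sum:
  fixes p :: nat
  assumes "Factorial_Ring.prime p" "finite I" "\<And>i. i \<in> I \<Longrightarrow> f i \<in> int_adjoin \<alpha>"
  shows "\<exists>w\<in>int_adjoin \<alpha>. (\<Sum>i\<in>I. f i) ^ p ^ e = (\<Sum>i\<in>I. f i ^ p ^ e) + of_nat p * w"
  using assms(2,3)
proof (induction I rule: finite_induct)
  case empty
  then show ?case
    using assms(1) by (intro bexI[of _ 0]) (auto simp: int_adjoin_0 power_0_left)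
next
  case (insert j I)
  then obtain w where w: "w \<in> int_adjoin \<alpha>"
      "(\<Sum>i\<in>I. f i) ^ p ^ e = (\<Sum>i\<in>I. f i ^ p ^ e) + of_nat p * w"
    by auto
  have in_ring: "f j \<in> int_adjoin \<alpha>" "(\<Sum>i\<in>I. f i) \<in> int_adjoin \<alpha>"
    using insert by (auto intro: int_adjoin_sum)
  then obtain w' where w': "w' \<in> int_adjoin \<alpha>"
      "(f j + (\<Sum>i\<in>I. f i)) ^ p ^ e = f j ^ p ^ e + (\<Sum>i\<in>I. f i) ^ p ^ e + of_nat p * f j * (\<Sum>i\<in>I. f i) * w'"
    using int_adjoin_prime_power_add[OF assms(1)] by blast
  show ?case
  proof (rule bexI)
    show "(\<Sum>i\<in>insert j I. f i) ^ p ^ e = (\<Sum>i\<in>insert j I. f i ^ p ^ e) + of_nat p * (w + f j * (\<Sum>i\<in>I. f i) * w')"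
      using insert(1,2) w(2) w'(2) by (simp add: algebra_simps)
    show "w + f j * (\<Sum>i\<in>I. f i) * w' \<in> int_adjoin \<alpha>"
      by (intro int_adjoin_closed w w' in_ring)
  qed
qed

lemma power_add_multiple:
  assumes "x \<in> int_adjoin \<alpha>" "y \<in> int_adjoin \<alpha>" "p \<in> int_adjoin \<alpha>"
  obtains z where "z \<in> int_adjoin \<alpha>" "(x + p * y) ^ k = x ^ k + p * z"
proof -
  have "\<exists>z\<in>int_adjoin \<alpha>. (x + p * y) ^ k = x ^ k + p * z"
  proof (induction k)
    case 0
    then show ?case by (intro bexI[of _ 0]) (auto intro: int_adjoin_0)
  next
    case (Suc k)
    then obtain z where z: "z \<in> int_adjoin \<alpha>" "(x + p * y) ^ k = x ^ k + p * z" by blast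
    show ?case
    proof (rule bexI)
      show "(x + p * y) ^ Suc k = x ^ Suc k + p * (x * z + y * x ^ k + p * y * z)"
        by (simp add: z(2) algebra_simps)
      show "x * z + y * x ^ k + p * y * z \<in> int_adjoin \<alpha>"
        by (intro int_adjoin_closed z assms)
    qed
  qed
  then show ?thesis using that by blast
qed

text \<open>Successively for \<open>j = 0, 1, \<dots>\<close>: subtract the terms already known to be divisible by \<open>p\<close> and
  multiply by \<open>\<pi>\<^sup>q\<^sup>-\<^sup>1\<^sup>-\<^sup>j\<close>; all terms but the \<open>j\<close>-th become divisible by \<open>p\<close>.\<close>
lemma int_adjoin_if_adic_expansion:
  assumes alpha: "algebraic_int \<alpha>" and x: "algebraic_int x" and p: "p \<noteq> 0"
    and expansion: "p * x = (\<Sum>j<q. r j * \<pi> ^ j)"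
    and pi: "\<pi> \<in> int_adjoin \<alpha>" "\<pi> ^ q = p * e" "e \<in> int_adjoin \<alpha>"
    and r: "\<And>j. j < q \<Longrightarrow> r j \<in> int_adjoin \<alpha>"
    and key: "\<And>j z. j < q \<Longrightarrow> algebraic_int z \<Longrightarrow> r j * \<pi> ^ (q - 1) = p * z \<Longrightarrow> \<exists>w\<in>int_adjoin \<alpha>. r j = p * w"
  shows "x \<in> int_adjoin \<alpha>"
proof -
  have div: "\<exists>w\<in>int_adjoin \<alpha>. r j = p * w" if "j < q" for j
    using that
  proof (induction j rule: less_induct)
    case (less j)
    then have "\<forall>k. \<exists>w. k < j \<longrightarrow> w \<in> int_adjoin \<alpha> \<and> r k = p * w" by (meson less_trans)
    then obtain w where "\<forall>k. k < j \<longrightarrow> w k \<in> int_adjoin \<alpha> \<and> r k = p * w k"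
      by (rule choice [THEN exE])
    then have w: "\<And>k. k < j \<Longrightarrow> w k \<in> int_adjoin \<alpha>" "\<And>k. k < j \<Longrightarrow> r k = p * w k"
      by auto
    define y where "y = x - (\<Sum>k<j. w k * \<pi> ^ k)"
    have split: "{..<q} = {..<j} \<union> ({j} \<union> {j<..<q})" using less.prems by auto
    have "p * x = (\<Sum>k<j. r k * \<pi> ^ k) + (r j * \<pi> ^ j + (\<Sum>k\<in>{j<..<q}. r k * \<pi> ^ k))"
      unfolding expansion split by (subst sum.union_disjoint; auto)+
    moreover have "(\<Sum>k<j. r k * \<pi> ^ k) = p * (\<Sum>k<j. w k * \<pi> ^ k)"
      unfolding sum_distrib_left by (intro sum.cong) (auto simp: w(2))
    ultimately have y: "p * y = r j * \<pi> ^ j + (\<Sum>k\<in>{j<..<q}. r k * \<pi> ^ k)"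
      by (simp add: y_def right_diff_distrib)
    \<comment> \<open>\<open>z\<close> is designed as the quotient of
      \<open>r j * \<pi> ^ (q - 1)\<close> by \<open>p\<close>: after multiplication by
      \<open>\<pi> ^ (q - 1 - j)\<close> each term with \<open>k > j\<close> has exponent at least
      \<open>q\<close> and so contains \<open>\<pi> ^ q = p * e\<close>.\<close>
    define z where "z = y * \<pi> ^ (q - 1 - j) - (\<Sum>k\<in>{j<..<q}. r k * \<pi> ^ (k - 1 - j)) * e"
    have tail: "(\<Sum>k\<in>{j<..<q}. r k * \<pi> ^ k) * \<pi> ^ (q - 1 - j) = p * ((\<Sum>k\<in>{j<..<q}. r k * \<pi> ^ (k - 1 - j)) * e)"
    proof -
      have "r k * \<pi> ^ k * \<pi> ^ (q - 1 - j) = r k * \<pi> ^ (k - 1 - j) * (p * e)" if "k \<in> {j<..<q}" for k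
      proof -
        have "k + (q - 1 - j) = (k - 1 - j) + q" using that by auto
        then have "\<pi> ^ k * \<pi> ^ (q - 1 - j) = \<pi> ^ (k - 1 - j) * (p * e)"
          by (metis pi(2) power_add)
        then show ?thesis by (simp add: mult.assoc)
      qed
      then have "(\<Sum>k\<in>{j<..<q}. r k * \<pi> ^ k) * \<pi> ^ (q - 1 - j) = (\<Sum>k\<in>{j<..<q}. r k * \<pi> ^ (k - 1 - j) * (p * e))"
        unfolding sum_distrib_right by (intro sum.cong) auto
      also have "\<dots> = (\<Sum>k\<in>{j<..<q}. r k * \<pi> ^ (k - 1 - j)) * (p * e)"
        by (rule sum_distrib_right [symmetric])
      finally show ?thesis by (simp only: mult_ac)
    qed
    have "j + (q - 1 - j) = q - 1" using less.prems by simp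
    then have "\<pi> ^ j * \<pi> ^ (q - 1 - j) = \<pi> ^ (q - 1)" by (metis power_add)
    then have "r j * \<pi> ^ (q - 1) = (p * y) * \<pi> ^ (q - 1 - j) - p * ((\<Sum>k\<in>{j<..<q}. r k * \<pi> ^ (k - 1 - j)) * e)"
      unfolding y distrib_right tail by (simp add: mult.assoc)
    also have "\<dots> = p * z" by (simp add: z_def right_diff_distrib mult.assoc)
    finally have "r j * \<pi> ^ (q - 1) = p * z" .
    moreover have "algebraic_int z"
    proof -
      have "(\<Sum>k<j. w k * \<pi> ^ k) \<in> int_adjoin \<alpha>"
        by (intro int_adjoin_closed pi) (simp add: w(1))
      moreover have "(\<Sum>k\<in>{j<..<q}. r k * \<pi> ^ (k - 1 - j)) * e \<in> int_adjoin \<alpha>"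
        by (intro int_adjoin_closed pi r) auto
      ultimately show ?thesis
        unfolding z_def y_def
        by (intro algebraic_int_diff algebraic_int_plus_times x algebraic_int_power
            int_adjoin_algebraic_int[OF _ alpha] pi)
    qed
    ultimately show ?case using key less.prems by blast
  qed
  then have "\<forall>j. \<exists>w. j < q \<longrightarrow> w \<in> int_adjoin \<alpha> \<and> r j = p * w" by meson
  then obtain w where "\<forall>j. j < q \<longrightarrow> w j \<in> int_adjoin \<alpha> \<and> r j = p * w j"
    by (rule choice [THEN exE])
  then have w: "\<And>j. j < q \<Longrightarrow> w j \<in> int_adjoin \<alpha>" "\<And>j. j < q \<Longrightarrow> r j = p * w j"
    by auto
  have "p * x = p * (\<Sum>j<q. w j * \<pi> ^ j)"
    unfolding expansion sum_distrib_left by (intro sum.cong) (auto simp: w(2))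
  then have "x = (\<Sum>j<q. w j * \<pi> ^ j)" using p by simp
  also have "\<dots> \<in> int_adjoin \<alpha>"
    by (intro int_adjoin_closed pi) (simp add: w(1))
  finally show ?thesis .
qed

subsection \<open>Maximality at a prime\<close>

context pure_radical
begin

lemma int_adjoin_eq_int_span: "int_adjoin \<alpha> = int_span (\<lambda>i. \<alpha> ^ i) {..<n}"
proof
  show "int_adjoin \<alpha> \<subseteq> int_span (\<lambda>i. \<alpha> ^ i) {..<n}"
  proof (rule int_adjoin_subset_int_span)
    show one: "1 \<in> int_span (\<lambda>i. \<alpha> ^ i) {..<n}"
      using int_span_base[of "{..<n}" 0 "\<lambda>i. \<alpha> ^ i"] n_pos by simp
    fix i assume i: "i \<in> {..<n}"
    show "\<alpha> * \<alpha> ^ i \<in> int_span (\<lambda>i. \<alpha> ^ i) {..<n}"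
    proof (cases "Suc i = n")
      case True
      then have "\<alpha> * \<alpha> ^ i = of_int m * 1" using root by auto
      then show ?thesis using int_span_scale[OF one] by presburger
    next
      case False
      then show ?thesis using int_span_base[of "{..<n}" "Suc i" "\<lambda>i. \<alpha> ^ i"] i by simp
    qed
  qed
  show "int_span (\<lambda>i. \<alpha> ^ i) {..<n} \<subseteq> int_adjoin \<alpha>"
    unfolding int_span_def by (auto intro!: int_adjoin_closed)
qed

lemma rat_eval_inject:
  assumes "degree P < n" "degree Q < n" "rat_eval P \<alpha> = rat_eval Q \<alpha>"
  shows "P = Q"
proof (rule ccontr)
  assume "P \<noteq> Q"
  then have "P - Q \<noteq> 0" by simp
  moreover have "F dvd P - Q"
    using assms(3) by (intro F_dvd_if_root) (simp add: rat_eval_diff)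
  ultimately have "n \<le> degree (P - Q)"
    using F_degree dvd_imp_degree_le by metis
  then show False using degree_diff_less[OF assms(1,2)] by simp
qed

text \<open>The power basis representation is unique because \<open>F\<close> is the minimal
  polynomial of \<alpha>; \<open>P\<close> therefore agrees with the integer polynomial
  \<open>Q\<close> that witnesses membership.\<close>

lemma coeff_Ints_if_int_adjoin:
  assumes "rat_eval P \<alpha> \<in> int_adjoin \<alpha>" "degree P < n"
  shows "coeff P i \<in> \<int>"
proof -
  obtain c where c: "rat_eval P \<alpha> = (\<Sum>i<n. of_int (c i) * \<alpha> ^ i)"
    using assms(1) by (auto simp: int_adjoin_eq_int_span int_span_def)
  define Q where "Q = (\<Sum>i<n. monom (rat_of_int (c i)) i)"
  have "coeff Q i = (if i < n then of_int (c i) else 0)" for i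
    by (simp add: Q_def coeff_sum)
  moreover from this have deg: "degree Q < n"
    using n_pos by (metis leading_coeff_0_iff degree_0)
  ultimately have "rat_eval Q \<alpha> = rat_eval P \<alpha>"
    unfolding c rat_eval_altdef_lessThan[OF deg] by (intro sum.cong) auto
  then have "P = Q" using rat_eval_inject deg assms(2) by metis
  then show ?thesis by (simp add: Q_def coeff_sum)
qed

text \<open>Values of rational polynomials at \<alpha> are closed under the field operations,
  inverses coming from \<open>bezout_F\<close>; reduction modulo \<open>F\<close> bounds the
  degree.\<close>

lemma rat_adjoin_rat_eval:
  assumes "x \<in> rat_adjoin \<alpha>"
  obtains P where "x = rat_eval P \<alpha>" "degree P < n"
proof -
  have "\<exists>P. x = rat_eval P \<alpha>"
    using assms unfolding rat_adjoin_def
  proof induction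
    case one
    show ?case by (intro exI[of _ 1]) (simp add: complex_ring_simps)
  next
    case (incl h)
    then show ?case by (intro exI[of _ "[:0, 1:]"]) (simp add: rat_eval_altdef)
  next
    case (a_inv h)
    then obtain P where "h = rat_eval P \<alpha>" by blast
    then have "- h = rat_eval (0 - P) \<alpha>" by (simp only: rat_eval_diff) simp
    then show ?case by (auto simp: complex_ring_uminus)
  next
    case (m_inv h)
    then obtain P where P: "h = rat_eval P \<alpha>" "h \<noteq> 0" by (auto simp: complex_ring_simps)
    then have "\<not> F dvd P" by (auto simp: rat_eval_mult F_eval root)
    then obtain Q where "rat_eval Q \<alpha> * h = 1" by (rule bezout_F) (simp add: P)
    then have "inverse h = rat_eval Q \<alpha>" by (metis inverse_unique mult.commute)
    then show ?case using P by (auto simp: complex_ring_inv)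
  next
    case (eng_add g h)
    then obtain P Q where "g = rat_eval P \<alpha>" "h = rat_eval Q \<alpha>" by blast
    then have "g + h = rat_eval (P + Q) \<alpha>" by (simp add: rat_eval_add)
    then show ?case by (auto simp: complex_ring_simps)
  next
    case (eng_mult g h)
    then obtain P Q where "g = rat_eval P \<alpha>" "h = rat_eval Q \<alpha>" by blast
    then have "g * h = rat_eval (P * Q) \<alpha>" by (simp add: rat_eval_mult)
    then show ?case by (auto simp: complex_ring_simps)
  qed
  then obtain P where P: "x = rat_eval P \<alpha>" by blast
  have "rat_eval P \<alpha> = rat_eval (P div F * F + P mod F) \<alpha>"
    by (simp only: div_mult_mod_eq)
  also have "\<dots> = rat_eval (P mod F) \<alpha>"
    by (simp only: rat_eval_add rat_eval_mult F_eval root) simp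
  finally have "x = rat_eval (P mod F) \<alpha>" by (simp add: P)
  moreover have "degree (P mod F) < n"
    using degree_mod_less[OF F_nonzero, of P] F_degree n_pos by auto
  ultimately show ?thesis using that by blast
qed

section \<open>Saturation at a prime\<close>

text \<open>For a prime \<open>p\<close> this says that \<open>p\<close> does not divide the index
  of \<int>[\<alpha>] in the ring of integers; an \<open>x\<close> with \<open>p * x\<close> in
  \<int>[\<alpha>] lies in \<rat>(\<alpha>).\<close>

definition saturated_at :: "nat \<Rightarrow> bool" where
  "saturated_at p \<longleftrightarrow> (\<forall>x. algebraic_int x \<longrightarrow> of_nat p * x \<in> int_adjoin \<alpha> \<longrightarrow> x \<in> int_adjoin \<alpha>)"

lemma int_adjoin_if_multiple:
  assumes "\<And>p. Factorial_Ring.prime p \<Longrightarrow> p dvd N \<Longrightarrow> saturated_at p" "N > 0"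
    and "algebraic_int x" "of_nat N * x \<in> int_adjoin \<alpha>"
  shows "x \<in> int_adjoin \<alpha>"
  using assms
proof (induction N arbitrary: x rule: prime_divisors_induct)
  case zero
  then show ?case by simp
next
  case (unit N)
  then show ?case by simp
next
  case (factor p N)
  have "saturated_at p" using factor.prems(1) factor.hyps by simp
  moreover have "algebraic_int (of_nat N * x)"
    by (intro algebraic_int_plus_times factor.prems(3) algebraic_int_of_nat)
  ultimately have "of_nat N * x \<in> int_adjoin \<alpha>"
    using factor.prems(4) by (simp add: saturated_at_def mult.assoc)
  moreover have "N > 0" using factor.prems(2) by simp
  moreover have "saturated_at q" if "Factorial_Ring.prime q" "q dvd N" for q
    using that by (intro factor.prems(1)) simp_all
  ultimately show ?case
    using factor.IH factor.prems(3) by blast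
qed

text \<open>The trace bound puts \<open>N * x\<close> into \<int>[\<alpha>] for
  \<open>N = n * \<bar>m\<bar>\<close>, so saturation at the primes dividing \<open>N\<close> is
  enough.\<close>

lemma ring_of_integers_eq_int_adjoin:
  assumes "\<And>p. Factorial_Ring.prime p \<Longrightarrow> p dvd n * nat \<bar>m\<bar> \<Longrightarrow> saturated_at p"
  shows "int_adjoin \<alpha> = ring_of_integers (rat_adjoin \<alpha>)"
proof
  show "int_adjoin \<alpha> \<subseteq> ring_of_integers (rat_adjoin \<alpha>)"
    unfolding ring_of_integers_def
    using int_adjoin_subset_rat_adjoin int_adjoin_algebraic_int alpha_algebraic_int by blast
  show "ring_of_integers (rat_adjoin \<alpha>) \<subseteq> int_adjoin \<alpha>"
  proof
    fix x assume "x \<in> ring_of_integers (rat_adjoin \<alpha>)"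
    then have x: "x \<in> rat_adjoin \<alpha>" "algebraic_int x" by (auto simp: ring_of_integers_def)
    obtain P where P: "x = rat_eval P \<alpha>" "degree P < n"
      using x(1) by (rule rat_adjoin_rat_eval)
    define N where "N = n * nat \<bar>m\<bar>"
    have "\<exists>c. of_nat N * coeff P i = of_int c" if "i < n" for i
    proof -
      have "of_nat n * of_int m * coeff P i \<in> \<int>"
        using coeff_algebraic_int P x that by metis
      moreover have "int N = sgn m * (int n * m)"
        by (simp add: N_def sgn_if)
      then have "of_nat N = rat_of_int (sgn m * (int n * m))"
        by (metis of_int_of_nat_eq)
      then have "of_nat N * coeff P i = of_int (sgn m) * (of_nat n * of_int m * coeff P i)"
        by simp
      ultimately have "of_nat N * coeff P i \<in> \<int>" by (metis Ints_mult Ints_of_int)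
      then show ?thesis by (auto simp: Ints_def)
    qed
    then have "\<forall>i. \<exists>c. i < n \<longrightarrow> of_nat N * coeff P i = of_int c" by blast
    then obtain c where c: "\<forall>i. i < n \<longrightarrow> of_nat N * coeff P i = of_int (c i)"
      by (rule choice [THEN exE])
    have "of_nat N * x = (\<Sum>i<n. of_rat (of_nat N * coeff P i) * \<alpha> ^ i)"
      by (simp add: P(1) rat_eval_altdef_lessThan[OF P(2)] sum_distrib_left of_rat_mult mult.assoc)
    also have "\<dots> = (\<Sum>i<n. of_int (c i) * \<alpha> ^ i)"
      using c by (intro sum.cong) auto
    also have "\<dots> \<in> int_adjoin \<alpha>" by (intro int_adjoin_closed)
    finally have "of_nat N * x \<in> int_adjoin \<alpha>" .
    moreover have "N > 0" using n_pos m_nonzero by (simp add: N_def)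
    ultimately show "x \<in> int_adjoin \<alpha>"
      using int_adjoin_if_multiple[of N x] assms x(2) unfolding N_def by metis
  qed
qed

text \<open>The expansion in powers of \<alpha> has integer digits. The \<open>n\<close>-th power of
  \<open>c * \<alpha> ^ (n - 1) = p * z\<close> is an equation between integers, and since
  \<open>p\<close> divides \<open>m\<close> exactly once, it forces \<open>p\<close> to divide
  \<open>c\<close>.\<close>

lemma saturated_at_prime_dvd:
  assumes p: "Factorial_Ring.prime p" and dvd: "int p dvd m"
  shows "saturated_at p"
  unfolding saturated_at_def
proof (intro allI impI)
  fix x assume x: "algebraic_int x" "of_nat p * x \<in> int_adjoin \<alpha>"
  obtain c where c: "of_nat p * x = (\<Sum>i<n. of_int (c i) * \<alpha> ^ i)"
    using x(2) by (auto simp: int_adjoin_eq_int_span int_span_def)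
  obtain e where e: "m = int p * e" using dvd by blast
  have pnz: "(of_nat p :: complex) \<noteq> 0" using p by auto
  have prime_int: "Factorial_Ring.prime (int p)" using p by simp
  have pe: "\<not> int p dvd e"
  proof
    assume "int p dvd e"
    then have "int p ^ 2 dvd m" by (simp add: e power2_eq_square)
    then have "is_unit (int p)" using sqfree by (simp only: squarefree_def)
    then show False using p by simp
  qed
  show "x \<in> int_adjoin \<alpha>"
  proof (rule int_adjoin_if_adic_expansion[OF alpha_algebraic_int x(1) pnz c])
    show "\<alpha> ^ n = of_nat p * of_int e" by (simp add: root e)
    fix i z assume z: "algebraic_int z" "of_int (c i) * \<alpha> ^ (n - 1) = of_nat p * z"
    have "(\<alpha> ^ (n - 1)) ^ n = of_int m ^ (n - 1)"
      by (simp only: root [symmetric] power_mult [symmetric] mult.commute)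
    then have "(of_int (c i) * \<alpha> ^ (n - 1)) ^ n = of_int (c i ^ n * m ^ (n - 1))"
      by (simp add: power_mult_distrib)
    then have "of_int (c i ^ n * m ^ (n - 1)) = of_nat p ^ n * z ^ n"
      by (simp only: z(2) power_mult_distrib)
    then have "z ^ n = of_int (c i ^ n * m ^ (n - 1)) / of_int (int p ^ n)"
      using pnz by (simp add: field_simps)
    then have "z ^ n \<in> \<rat>" by (metis Rats_divide Rats_of_int)
    then obtain w where w: "z ^ n = of_int w"
      using rational_algebraic_int_is_int algebraic_int_power[OF z(1)] by (auto simp: Ints_def)
    have "(of_int (c i ^ n * m ^ (n - 1)) :: complex) = of_int (int p ^ n * w)"
      using \<open>of_int (c i ^ n * m ^ (n - 1)) = of_nat p ^ n * z ^ n\<close> w by simp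
    then have "c i ^ n * m ^ (n - 1) = int p ^ n * w"
      by (simp only: of_int_eq_iff)
    also have "int p ^ n = int p ^ (n - 1) * int p"
      using n_pos by (metis Suc_diff_1 power_Suc2)
    \<comment> \<open>After cancelling \<open>p ^ (n - 1)\<close> one factor \<open>p\<close> is
      left on the right, while \<open>e\<close> is prime to \<open>p\<close>.\<close>
    finally have "int p ^ (n - 1) * (c i ^ n * e ^ (n - 1)) = int p ^ (n - 1) * (int p * w)"
      by (simp add: e power_mult_distrib mult_ac)
    then have "c i ^ n * e ^ (n - 1) = int p * w"
      using p by simp
    then have "int p dvd c i ^ n * e ^ (n - 1)" by simp
    then have "int p dvd c i"
      using p pe prime_int by (auto simp: prime_dvd_mult_iff dest: prime_dvd_power [OF prime_int])
    then obtain d where "c i = int p * d" by blast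
    then show "\<exists>w\<in>int_adjoin \<alpha>. of_int (c i) = of_nat p * w"
      by (intro bexI[of _ "of_int d"]) (auto intro: int_adjoin_closed)
  qed (intro int_adjoin_closed)+
qed

text \<open>With \<open>q = p\<^sup>e\<close>, the element \<open>\<pi> = \<alpha>\<^sup>a - m\<close> satisfies \<open>\<pi>\<^sup>q = p f\<close> with \<open>f\<close> congruent to \<open>t\<close>
  modulo \<open>\<pi>\<close>, hence \<open>f\<close> divides an integer prime to \<open>p\<close> modulo \<open>p\<close>. Modulo \<open>p\<close>, the
  \<open>q\<close>-th power of a digit \<open>r\<close> of the \<open>\<pi>\<close>-adic expansion lies in \<open>\<int>[\<alpha>\<^sup>q]\<close>, and the trace argument
  applies there because \<open>a\<close> is prime to \<open>p\<close>.\<close>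
lemma saturated_at_prime_dvd_degree:
  assumes p: "Factorial_Ring.prime p" and n: "n = p ^ e * a" and a: "\<not> p dvd a"
    and pm: "\<not> int p dvd m" and t: "m - m ^ p ^ e = int p * t" "\<not> int p dvd t"
  shows "saturated_at p"
proof -
  define q where "q = p ^ e"
  define \<pi> where "\<pi> = \<alpha> ^ a - of_int m"
  have q: "q > 0" using p by (simp add: q_def prime_gt_0_nat)
  have a_pos: "a > 0" using n n_pos by auto
  have p0: "(of_nat p :: complex) \<noteq> 0" using p by auto
  have prime_int: "Factorial_Ring.prime (int p)" using p by simp
  interpret sub: pure_radical a m "\<alpha> ^ q"
    using a_pos sqfree m_neq root n by unfold_locales (simp_all add: q_def flip: power_mult)
  have pi: "\<pi> \<in> int_adjoin \<alpha>" unfolding \<pi>_def by (intro int_adjoin_closed)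
  have gamma: "(\<pi> + of_int m) ^ q = of_int m"
    using root n by (simp add: \<pi>_def q_def mult.commute flip: power_mult)
  obtain s where s: "s \<in> int_adjoin \<alpha>"
      "(\<pi> + of_int m) ^ q = \<pi> ^ q + of_int m ^ q + of_nat p * \<pi> * of_int m * s"
    unfolding q_def by (rule int_adjoin_prime_power_add[OF p pi int_adjoin_of_int])
  define y where "y = \<pi> * (of_int m * s)"
  define f where "f = of_int t - y"
  have y: "y \<in> int_adjoin \<alpha>" unfolding y_def by (intro int_adjoin_closed pi s)
  then have f: "f \<in> int_adjoin \<alpha>" unfolding f_def by (intro int_adjoin_closed)
  have t_complex: "of_int m - of_int m ^ q = of_nat p * (of_int t :: complex)"
    using arg_cong[OF t(1), of complex_of_int] by (simp add: q_def)
  have "\<pi> ^ q = (of_int m - of_int m ^ q) - of_nat p * \<pi> * of_int m * s"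
    using s(2) unfolding gamma by (simp add: algebra_simps)
  then have pi_power: "\<pi> ^ q = of_nat p * f"
    unfolding t_complex by (simp add: f_def y_def algebra_simps)

  \<comment> \<open>Cofactor in \<open>f * g = t ^ q - y ^ q\<close>. As \<open>y ^ q\<close>
    contains \<open>\<pi> ^ q = p * f\<close>, the product \<open>f * g\<close> is
    \<open>t ^ q\<close> modulo \<open>p\<close>.\<close>
  define g where "g = (\<Sum>i<q. y ^ (q - Suc i) * of_int t ^ i)"
  have g: "g \<in> int_adjoin \<alpha>" unfolding g_def by (intro int_adjoin_closed y)
  define h where "h = - (f * (of_int m * s) ^ q)"
  have h: "h \<in> int_adjoin \<alpha>" unfolding h_def by (intro int_adjoin_closed f s)
  have "f * g = of_int t ^ q - y ^ q"
    unfolding f_def g_def by (rule power_diff_sumr2 [symmetric])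
  also have "y ^ q = of_nat p * f * (of_int m * s) ^ q"
    unfolding y_def by (simp only: power_mult_distrib[of \<pi>] pi_power)
  finally have fg: "f * g = of_int (t ^ q) + of_nat p * h"
    by (simp add: h_def)
  obtain h' where h': "h' \<in> int_adjoin \<alpha>"
      "(of_int (t ^ q) + of_nat p * h) ^ (q - 1) = of_int (t ^ q) ^ (q - 1) + of_nat p * h'"
    using power_add_multiple[OF int_adjoin_of_int h int_adjoin_of_nat] by metis
  \<comment> \<open>The power of \<open>t\<close> that arises from \<open>(f * g) ^ (q - 1)\<close>
    is inverted modulo \<open>p\<close> by a Bezout identity.\<close>
  have "coprime ((t ^ q) ^ (q - 1)) (int p)"
    using t(2) prime_int by (simp add: coprime_commute[of _ "int p"] prime_imp_coprime)
  then obtain b d where "b * (t ^ q) ^ (q - 1) + d * int p = 1"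
    using bezout_int[of "(t ^ q) ^ (q - 1)" "int p"] by auto
  then have bd: "of_int b * of_int (t ^ q) ^ (q - 1) + of_int d * of_nat p = (1 :: complex)"
    by (metis of_int_1 of_int_add of_int_mult of_int_of_nat_eq of_int_power)

  \<comment> \<open>The elements \<open>\<alpha> ^ i * \<pi> ^ j\<close> replace the power basis:
    \<open>\<alpha> ^ a = m + \<pi>\<close> reduces \<open>i\<close>, and the expansion of
    \<open>(\<pi> + m) ^ q = m\<close> reduces \<open>j\<close>.\<close>
  define I where "I = {..<a} \<times> {..<q}"
  define v where "v = (\<lambda>(i, j). \<alpha> ^ i * \<pi> ^ j)"
  have "finite I" by (simp add: I_def)
  then have base: "\<alpha> ^ i * \<pi> ^ j \<in> int_span v I" if "i < a" "j < q" for i j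
    using int_span_base[of I "(i, j)" v] that by (simp add: I_def v_def)
  have base_pi: "\<pi> ^ j \<in> int_span v I" if "j < q" for j
    using base[of 0 j] a_pos that by simp
  have pi_q: "\<pi> ^ q \<in> int_span v I"
  proof -
    have "of_int m = (\<Sum>l\<le>q. of_nat (q choose l) * \<pi> ^ l * of_int m ^ (q - l))"
      using binomial_ring[of \<pi> "of_int m" q] unfolding gamma .
    also have "\<dots> = (\<Sum>l<q. of_nat (q choose l) * \<pi> ^ l * of_int m ^ (q - l)) + \<pi> ^ q"
      by (simp flip: lessThan_Suc_atMost)
    also have "(\<Sum>l<q. of_nat (q choose l) * \<pi> ^ l * of_int m ^ (q - l)) =
        (\<Sum>l<q. of_int (int (q choose l) * m ^ (q - l)) * \<pi> ^ l)"
      by (intro sum.cong) (simp_all add: mult_ac)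
    finally have "of_int m = (\<Sum>l<q. of_int (int (q choose l) * m ^ (q - l)) * \<pi> ^ l) + \<pi> ^ q" .
    then have "\<pi> ^ q = of_int m - (\<Sum>l<q. of_int (int (q choose l) * m ^ (q - l)) * \<pi> ^ l)"
      by (metis add_diff_cancel_left')
    then have "\<pi> ^ q = of_int m * \<pi> ^ 0 + of_int (- 1) * (\<Sum>l<q. of_int (int (q choose l) * m ^ (q - l)) * \<pi> ^ l)"
      by simp
    also have "\<dots> \<in> int_span v I"
      using q by (intro int_span_add int_span_scale int_span_sum base_pi) auto
    finally show ?thesis .
  qed
  have span: "int_adjoin \<alpha> \<subseteq> int_span v I"
  proof (rule int_adjoin_subset_int_span)
    show "1 \<in> int_span v I" using base_pi[of 0] q by simp
    fix k assume "k \<in> I"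
    then obtain i j where k: "k = (i, j)" "i < a" "j < q" unfolding I_def by (elim SigmaE) auto
    then have v_k: "v k = \<alpha> ^ i * \<pi> ^ j" by (simp add: v_def)
    show "\<alpha> * v k \<in> int_span v I"
    proof (cases "Suc i = a")
      case False
      then show ?thesis using base[of "Suc i" j] k(2,3) by (simp add: v_k mult.assoc)
    next
      case True
      then have "\<alpha> * \<alpha> ^ i = of_int m + \<pi>" by (auto simp: \<pi>_def)
      then have "\<alpha> * v k = of_int m * \<pi> ^ j + \<pi> ^ Suc j"
        unfolding v_k mult.assoc [symmetric] by (simp add: distrib_right)
      moreover have "\<pi> ^ Suc j \<in> int_span v I"
        using base_pi[of "Suc j"] pi_q k(3) by (cases "Suc j = q") auto
      ultimately show ?thesis
        using base_pi[OF k(3)] by (simp only: int_span_add int_span_scale)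
    qed
  qed

  show ?thesis
    unfolding saturated_at_def
  proof (intro allI impI)
    fix x assume x: "algebraic_int x" "of_nat p * x \<in> int_adjoin \<alpha>"
    then obtain c where c: "of_nat p * x = (\<Sum>k\<in>I. of_int (c k) * v k)"
      using span by (auto simp: int_span_def)
    define r where "r = (\<lambda>j. \<Sum>i<a. of_int (c (i, j)) * \<alpha> ^ i)"
    have "of_nat p * x = (\<Sum>i<a. \<Sum>j<q. of_int (c (i, j)) * \<alpha> ^ i * \<pi> ^ j)"
      unfolding c I_def v_def by (simp add: sum.cartesian_product mult.assoc case_prod_unfold)
    also have "\<dots> = (\<Sum>j<q. r j * \<pi> ^ j)"
      unfolding r_def sum_distrib_right by (rule sum.swap)
    finally have expansion: "of_nat p * x = (\<Sum>j<q. r j * \<pi> ^ j)" .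
    show "x \<in> int_adjoin \<alpha>"
    proof (rule int_adjoin_if_adic_expansion[OF alpha_algebraic_int x(1) p0 expansion pi pi_power f])
      fix j z
      show r: "r j \<in> int_adjoin \<alpha>" unfolding r_def by (intro int_adjoin_closed)
      assume z: "algebraic_int z" "r j * \<pi> ^ (q - 1) = of_nat p * z"
      \<comment> \<open>Taking \<open>q\<close>-th powers turns \<open>\<pi> ^ (q - 1)\<close> into
        \<open>(p * f) ^ (q - 1)\<close>. Cancelling \<open>p ^ (q - 1)\<close> and then removing
        \<open>f\<close> by means of \<open>g\<close> and the Bezout identity shows that
        \<open>r j ^ q\<close> is \<open>p\<close> times an integral element
        \<open>z2\<close>.\<close>
      have "(r j * \<pi> ^ (q - 1)) ^ q = r j ^ q * (of_nat p * f) ^ (q - 1)"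
        by (simp only: power_mult_distrib[of "r j"] pi_power [symmetric] power_mult [symmetric] mult.commute[of q])
      then have "of_nat p ^ (q - 1) * (r j ^ q * f ^ (q - 1)) = of_nat p ^ q * z ^ q"
        unfolding z(2) power_mult_distrib by (simp only: mult_ac)
      also have "of_nat p ^ q = of_nat p ^ (q - 1) * (of_nat p :: complex)"
        using q by (metis Suc_diff_1 power_Suc2)
      finally have "r j ^ q * f ^ (q - 1) = of_nat p * z ^ q"
        using p0 by (simp add: mult.assoc)
      moreover have "r j ^ q * (of_int (t ^ q) ^ (q - 1) + of_nat p * h') = (r j ^ q * f ^ (q - 1)) * g ^ (q - 1)"
        by (simp only: h'(2) [symmetric] fg [symmetric] power_mult_distrib mult.assoc)
      ultimately have mult_t: "r j ^ q * of_int (t ^ q) ^ (q - 1) = of_nat p * (z ^ q * g ^ (q - 1) - r j ^ q * h')"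
        by (simp add: algebra_simps)
      define z2 where "z2 = of_int b * (z ^ q * g ^ (q - 1) - r j ^ q * h') + of_int d * r j ^ q"
      have "r j ^ q = of_int b * (r j ^ q * of_int (t ^ q) ^ (q - 1)) + of_int d * of_nat p * r j ^ q"
        using arg_cong[OF bd, of "\<lambda>x. x * r j ^ q"] by (simp add: algebra_simps)
      also have "\<dots> = of_nat p * z2"
        unfolding mult_t z2_def by (simp add: algebra_simps)
      finally have z2: "r j ^ q = of_nat p * z2" .
      \<comment> \<open>Modulo \<open>p\<close> the \<open>q\<close>-th power acts termwise, so
        \<open>r j ^ q\<close> becomes a polynomial in \<open>\<alpha> ^ q\<close>.\<close>
      obtain w where w: "w \<in> int_adjoin \<alpha>"
          "r j ^ q = (\<Sum>i<a. (of_int (c (i, j)) * \<alpha> ^ i) ^ q) + of_nat p * w"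
        unfolding r_def q_def
        using int_adjoin_prime_power_sum[OF p, of "{..<a}" "\<lambda>i. of_int (c (i, j)) * \<alpha> ^ i" \<alpha> e]
        by (auto intro: int_adjoin_closed)
      have "(\<Sum>i<a. of_int (c (i, j)) ^ q * (\<alpha> ^ q) ^ i) = (\<Sum>i<a. (of_int (c (i, j)) * \<alpha> ^ i) ^ q)"
        by (intro sum.cong) (simp_all add: power_mult_distrib mult.commute flip: power_mult)
      then have digit: "(\<Sum>i<a. of_int (c (i, j)) ^ q * (\<alpha> ^ q) ^ i) = of_nat p * (z2 - w)"
        using w(2) z2 by (simp add: right_diff_distrib)
      have "algebraic_int (z2 - w)"
        unfolding z2_def
        by (intro algebraic_int_diff algebraic_int_plus_times algebraic_int_power algebraic_int_of_int z(1)
            int_adjoin_algebraic_int[OF _ alpha_algebraic_int] w g r h')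
      \<comment> \<open>This polynomial divided by \<open>p\<close>: its value at
        \<open>\<alpha> ^ q\<close> is the integral element \<open>z2 - w\<close>, so the trace
        bound applies to each coefficient \<open>c (i, j) ^ q / p\<close>.\<close>
      define B where "B = (\<Sum>i<a. monom (rat_of_int (c (i, j) ^ q) / of_nat p) i)"
      have coeff_B: "coeff B i = (if i < a then of_int (c (i, j) ^ q) / of_nat p else 0)" for i
        by (simp add: B_def coeff_sum)
      have deg_B: "degree B < a"
        using coeff_B a_pos by (metis leading_coeff_0_iff degree_0)
      have "of_nat p * rat_eval B (\<alpha> ^ q) = of_nat p * (z2 - w)"
        unfolding rat_eval_altdef_lessThan[OF deg_B] digit [symmetric] sum_distrib_left
        using p0 by (intro sum.cong) (auto simp: coeff_B of_rat_divide of_rat_power)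
      then have "rat_eval B (\<alpha> ^ q) = z2 - w" using p0 by simp
      then have int_B: "algebraic_int (rat_eval B (\<alpha> ^ q))"
        using \<open>algebraic_int (z2 - w)\<close> by simp
      have "\<exists>d. c (i, j) = int p * d" if i: "i < a" for i
      proof -
        have "of_nat a * of_int m * coeff B i \<in> \<int>"
          using int_B deg_B i by (rule sub.coeff_algebraic_int)
        then obtain k where "of_nat a * of_int m * coeff B i = of_int k" by (auto simp: Ints_def)
        then have "rat_of_int (int a * m * c (i, j) ^ q) = of_int (int p * k)"
          using i p by (simp add: coeff_B field_simps)
        then have "int a * m * c (i, j) ^ q = int p * k" by (simp only: of_int_eq_iff)
        then have "int p dvd int a * m * c (i, j) ^ q" by simp
        then have "int p dvd c (i, j)"
          using a pm prime_int by (auto simp: prime_dvd_mult_iff dest: prime_dvd_power [OF prime_int])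
        then show ?thesis by (auto simp: dvd_def)
      qed
      then have "\<forall>i. \<exists>d. i < a \<longrightarrow> c (i, j) = int p * d" by blast
      then obtain c' where c': "\<forall>i. i < a \<longrightarrow> c (i, j) = int p * c' i"
        by (rule choice [THEN exE])
      have "r j = of_nat p * (\<Sum>i<a. of_int (c' i) * \<alpha> ^ i)"
        unfolding r_def sum_distrib_left using c' by (intro sum.cong) auto
      moreover have "(\<Sum>i<a. of_int (c' i) * \<alpha> ^ i) \<in> int_adjoin \<alpha>" by (intro int_adjoin_closed)
      ultimately show "\<exists>w\<in>int_adjoin \<alpha>. r j = of_nat p * w" by blast
    qed
  qed
qed

end

subsection \<open>Integral elements outside the generated ring\<close>

lemma of_int_divide_notin_Ints:
  assumes "\<not> d dvd s" "d \<noteq> 0"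
  shows "(of_int s / of_int d :: rat) \<notin> \<int>"
proof
  assume "(of_int s / of_int d :: rat) \<in> \<int>"
  then obtain k where "(of_int s / of_int d :: rat) = of_int k" by (auto simp: Ints_def)
  then have "rat_of_int s = of_int (d * k)" using assms(2) by (simp add: field_simps)
  then have "s = d * k" by (simp only: of_int_eq_iff)
  then show False using assms(1) by simp
qed

lemma rat_adjoin_of_int: "of_int k \<in> rat_adjoin \<alpha>"
  by (intro int_adjoin_subset_rat_adjoin int_adjoin_of_int)

lemma rat_adjoin_of_rat: "of_rat c \<in> rat_adjoin \<alpha>"
proof (cases c)
  case (Fract a b)
  then have "(of_rat c :: complex) = of_int a / of_int b" by (simp add: of_rat_rat)
  then show ?thesis using Fract(2) by (auto intro!: rat_adjoin_divide rat_adjoin_of_int)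
qed

lemma rat_eval_rat_adjoin: "rat_eval P \<alpha> \<in> rat_adjoin \<alpha>"
proof -
  have power: "\<alpha> ^ i \<in> rat_adjoin \<alpha>" for i
    by (intro int_adjoin_subset_rat_adjoin int_adjoin_closed)
  have "(\<Sum>i\<in>I. of_rat (coeff P i) * \<alpha> ^ i) \<in> rat_adjoin \<alpha>" for I
  proof (induction I rule: infinite_finite_induct)
    case (insert i I)
    then show ?case
      by (simp add: rat_adjoin_add rat_adjoin_mult rat_adjoin_of_rat power)
  qed (use rat_adjoin_of_int[of 0 \<alpha>] in simp_all)
  then show ?thesis unfolding rat_eval_altdef .
qed

context pure_radical
begin

text \<open>By uniqueness of the power basis representation, an integral element with a non-integral
  coefficient lies outside \<int>[\<alpha>].\<close>

lemma int_adjoin_neq_ring_of_integers: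
  assumes "algebraic_int (rat_eval B \<alpha>)" "degree B < n" "coeff B i \<notin> \<int>"
  shows "int_adjoin \<alpha> \<noteq> ring_of_integers (rat_adjoin \<alpha>)"
proof
  assume "int_adjoin \<alpha> = ring_of_integers (rat_adjoin \<alpha>)"
  then have "rat_eval B \<alpha> \<in> int_adjoin \<alpha>"
    using assms(1) rat_eval_rat_adjoin by (simp add: ring_of_integers_def)
  then show False using coeff_Ints_if_int_adjoin assms(2,3) by blast
qed

text \<open>With \<open>m = 1 + 4 * k\<close> and \<open>\<alpha> ^ h\<close> a square root of
  \<open>m\<close>, the element \<open>(1 + \<alpha> ^ h) / 2\<close> is a root of
  \<open>X ^ 2 - X - k\<close>.\<close>

lemma int_adjoin_neq_if_cong_1_mod_4:
  assumes n: "n = 2 * h" and m: "[m = 1] (mod 4)"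
  shows "int_adjoin \<alpha> \<noteq> ring_of_integers (rat_adjoin \<alpha>)"
proof -
  obtain k where k: "m = 1 + 4 * k"
    using m by (metis cong_iff_lin cong_sym)
  have h: "h > 0" using n n_pos by simp
  define x where "x = (1 + \<alpha> ^ h) / 2"
  have gamma: "\<alpha> ^ h * \<alpha> ^ h = 1 + 4 * of_int k"
    using root unfolding n k by (simp add: mult_2 power_add)
  have "4 * (x * x - x - of_int k) = \<alpha> ^ h * \<alpha> ^ h - 1 - 4 * of_int k"
    by (simp add: x_def field_simps)
  then have "4 * (x * x - x - of_int k) = 4 * 0" unfolding gamma by simp
  then have "x * x - x - of_int k = 0" by (simp only: mult_cancel_left) simp
  then have "algebraic_int x"
    by (intro algebraic_int.intros[of "[:of_int (- k), - 1, 1:]"])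
      (auto simp: coeff_pCons algebra_simps split: nat.split)
  define B where "B = monom (1 / 2 :: rat) 0 + monom (1 / 2) h"
  have coeff_B: "coeff B i = (if i = 0 \<or> i = h then 1 / 2 else 0)" for i
    using h by (auto simp: B_def)
  have deg: "degree B < n"
    unfolding B_def using h n by (intro degree_add_less) (auto intro: le_less_trans[OF degree_monom_le])
  have "rat_eval B \<alpha> = x"
    by (simp add: B_def rat_eval_add map_poly_monom poly_monom x_def of_rat_divide add_divide_distrib)
  moreover have "coeff B h \<notin> \<int>"
    using of_int_divide_notin_Ints[of 2 1] by (simp add: coeff_B)
  ultimately show ?thesis
    using int_adjoin_neq_ring_of_integers \<open>algebraic_int x\<close> deg by blast
qed

text \<open>For \<open>\<delta>\<^sup>3 = 1 + 9 k\<close>, the number \<open>(1 + \<delta> + \<delta>\<^sup>2) / 3\<close> is a root of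
  \<open>X\<^sup>3 - X\<^sup>2 - 3 k X - 3 k\<^sup>2\<close>.\<close>
lemma int_adjoin_neq_if_cong_mod_9:
  assumes n: "n = 3 * h" and m: "[s * m = 1] (mod 9)" and s: "s = 1 \<or> s = - 1"
  shows "int_adjoin \<alpha> \<noteq> ring_of_integers (rat_adjoin \<alpha>)"
proof -
  obtain k where k: "s * m = 1 + 9 * k"
    using m by (metis cong_iff_lin cong_sym)
  have h: "h > 0" using n n_pos by simp
  \<comment> \<open>The sign is absorbed into \<delta>: its cube is
    \<open>s ^ 3 * m = s * m\<close>, so both residues of \<open>m\<close> are covered by one cubic
    equation.\<close>
  define \<delta> where "\<delta> = of_int s * \<alpha> ^ h"
  define x where "x = (1 + \<delta> + \<delta> ^ 2) / 3"
  have "\<delta> ^ 3 = of_int (s ^ 3 * m)"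
    using root unfolding n by (simp add: \<delta>_def power_mult_distrib mult.commute flip: power_mult)
  also have "s ^ 3 * m = 1 + 9 * k"
    using s k by auto
  finally have k': "of_int k = (\<delta> ^ 3 - 1) / 9" by simp
  have "x ^ 3 - x ^ 2 - 3 * of_int k * x - 3 * of_int k ^ 2 = 0"
    unfolding k' x_def by (simp add: field_simps power2_eq_square power3_eq_cube)
  then have "algebraic_int x"
    by (intro algebraic_int.intros[of "[:of_int (- 3 * k ^ 2), of_int (- 3 * k), - 1, 1:]"])
      (auto simp: coeff_pCons algebra_simps power2_eq_square power3_eq_cube split: nat.split)
  define B where "B = monom (1 / 3 :: rat) 0 + monom (of_int s / 3) h + monom (1 / 3) (2 * h)"
  have deg: "degree B < n"
    unfolding B_def using h n by (intro degree_add_less) (auto intro: le_less_trans[OF degree_monom_le])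
  have "\<delta> ^ 2 = \<alpha> ^ (2 * h)"
    using s by (auto simp: \<delta>_def power_mult_distrib mult.commute[of 2] simp flip: power_mult)
  then have "rat_eval B \<alpha> = x"
    by (simp add: B_def rat_eval_add map_poly_monom poly_monom x_def \<delta>_def of_rat_divide add_divide_distrib)
  moreover have coeff: "coeff B h = of_int s / of_int 3" using h by (simp add: B_def)
  have "coeff B h \<notin> \<int>"
    unfolding coeff by (rule of_int_divide_notin_Ints) (use s in auto)
  ultimately show ?thesis
    using int_adjoin_neq_ring_of_integers \<open>algebraic_int x\<close> deg by blast
qed

end

section \<open>The congruence conditions in terms of \<open>m - m ^ p ^ e\<close>\<close>

text \<open>An odd \<open>m\<close> has square 1 modulo 4, hence \<open>m ^ 2 ^ u\<close> is 1 while
  \<open>m\<close> is 3, and the difference is 2 modulo 4. This is the condition on \<open>t\<close>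
  for saturation at 2.\<close>

lemma minus_power_two_exponent_mod_4:
  fixes m :: int
  assumes "odd m" "\<not> [m = 1] (mod 4)" "u > 0"
  obtains t where "m - m ^ 2 ^ u = 2 * t" "\<not> 2 dvd t"
proof -
  have "[m ^ 2 = 1] (mod 4)"
  proof -
    have "m mod 4 = 1 \<or> m mod 4 = 3" using assms(1) by presburger
    moreover have "[m ^ 2 = (m mod 4) ^ 2] (mod 4)" by (simp add: cong_def power_mod)
    ultimately show ?thesis by (auto simp: cong_def)
  qed
  then have "[(m ^ 2) ^ 2 ^ (u - 1) = 1 ^ 2 ^ (u - 1)] (mod 4)" by (rule cong_pow)
  moreover have "2 * 2 ^ (u - 1) = (2 ^ u :: nat)"
    using assms(3) by (simp flip: power_Suc)
  then have "(m ^ 2) ^ 2 ^ (u - 1) = m ^ 2 ^ u"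
    by (metis power_mult)
  ultimately have "m ^ 2 ^ u mod 4 = 1" by (simp add: cong_def)
  moreover have "m mod 4 = 3" using assms(1,2) unfolding cong_def by presburger
  ultimately have "(m - m ^ 2 ^ u) mod 4 = 2" by presburger
  moreover have "d = 2 * (d div 2) \<and> \<not> 2 dvd d div 2" if "d mod 4 = 2" for d :: int
    using that by presburger
  ultimately show ?thesis using that by blast
qed

text \<open>Modulo 9 the cube of \<open>m\<close> is a sign \<open>s\<close> congruent to
  \<open>m\<close> modulo 3, and further cubing fixes \<open>s\<close>. As \<open>m\<close> itself
  is not \<open>s\<close> modulo 9, the difference is 3 or 6.\<close>

lemma minus_power_three_exponent_mod_9:
  fixes m :: int
  assumes "\<not> 3 dvd m" "\<not> [m = 1] (mod 9)" "\<not> [m = - 1] (mod 9)" "v > 0"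
  obtains t where "m - m ^ 3 ^ v = 3 * t" "\<not> 3 dvd t"
proof -
  have cases: "m mod 9 = 2 \<or> m mod 9 = 4 \<or> m mod 9 = 5 \<or> m mod 9 = 7"
  proof -
    define r where "r = m mod 9"
    have "0 \<le> r" "r < 9" by (simp_all add: r_def)
    then have "r \<in> {0, 1, 2, 3, 4, 5, 6, 7, 8}" by auto
    moreover have "\<not> 3 dvd r" using assms(1) by (simp add: r_def dvd_mod_iff)
    moreover have "r \<noteq> 1" "r \<noteq> 8" using assms(2,3) by (simp_all add: r_def cong_def)
    ultimately show ?thesis by (auto simp: r_def [symmetric])
  qed
  have "\<exists>s. [m ^ 3 = s] (mod 9) \<and> ((s = 1 \<and> m mod 9 \<in> {4, 7}) \<or> (s = - 1 \<and> m mod 9 \<in> {2, 5}))"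
  proof -
    have "[m ^ 3 = (m mod 9) ^ 3] (mod 9)" by (simp add: cong_def power_mod)
    then show ?thesis using cases by (auto simp: cong_def)
  qed
  then obtain s where s: "[m ^ 3 = s] (mod 9)" "(s = 1 \<and> m mod 9 \<in> {4, 7}) \<or> (s = - 1 \<and> m mod 9 \<in> {2, 5})"
    by blast
  have "[(m ^ 3) ^ 3 ^ (v - 1) = s ^ 3 ^ (v - 1)] (mod 9)" using s(1) by (rule cong_pow)
  moreover have "s ^ 3 ^ (v - 1) = s" using s(2) by (auto simp: uminus_power_if)
  moreover have "3 * 3 ^ (v - 1) = (3 ^ v :: nat)"
    using assms(4) by (simp flip: power_Suc)
  then have "(m ^ 3) ^ 3 ^ (v - 1) = m ^ 3 ^ v"
    by (metis power_mult)
  ultimately have "m ^ 3 ^ v mod 9 = s mod 9" by (simp add: cong_def)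
  then have "(m - m ^ 3 ^ v) mod 9 = 3 \<or> (m - m ^ 3 ^ v) mod 9 = 6"
    using s(2) by (auto simp: mod_diff_eq [symmetric, of m])
  moreover have "d = 3 * (d div 3) \<and> \<not> 3 dvd d div 3" if "d mod 9 = 3 \<or> d mod 9 = 6" for d :: int
    using that by presburger
  ultimately show ?thesis using that by blast
qed

section \<open>The criterion for exponent \<open>2 ^ u * 3 ^ v\<close>\<close>

theorem theorem2p1:
  fixes u v :: nat and m :: int and F :: "rat poly"
    and \<alpha> :: complex and K :: "complex set"
  assumes "u > 0" and "v > 0"
    and "squarefree m" and "m \<noteq> 1" and "m \<noteq> - 1"
    and "F = monom 1 (2 ^ u * 3 ^ v) - [:of_int m:]"
    and "poly (map_poly of_rat F) \<alpha> = 0"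
    and "K = rat_adjoin \<alpha>"
  shows "lead_coeff F = 1 \<and> Factorial_Ring.irreducible F \<and>
    (int_adjoin \<alpha> = ring_of_integers K \<longleftrightarrow>
      \<not> [m = 1] (mod 4) \<and> \<not> [m = 1] (mod 9) \<and> \<not> [m = - 1] (mod 9))"
proof -
  have "rat_eval F \<alpha> = \<alpha> ^ (2 ^ u * 3 ^ v) - of_int m"
    unfolding assms(6) by (simp only: rat_eval_diff rat_eval_const) (simp add: map_poly_monom poly_monom)
  then have root: "\<alpha> ^ (2 ^ u * 3 ^ v) = of_int m" using assms(7) by simp
  interpret radical: pure_radical "2 ^ u * 3 ^ v" m \<alpha>
    using assms(3-5) root by unfold_locales auto
  have F: "F = radical.F" by (simp add: assms(6) radical.F_def)
  have "int_adjoin \<alpha> \<noteq> ring_of_integers K" if "[m = 1] (mod 4)"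
    unfolding assms(8) using that assms(1)
    by (intro radical.int_adjoin_neq_if_cong_1_mod_4[of "2 ^ (u - 1) * 3 ^ v"])
      (simp_all flip: power_Suc)
  moreover have "int_adjoin \<alpha> \<noteq> ring_of_integers K" if "[s * m = 1] (mod 9)" "s = 1 \<or> s = - 1" for s
    unfolding assms(8) using that assms(2)
    by (intro radical.int_adjoin_neq_if_cong_mod_9[of "2 ^ u * 3 ^ (v - 1)" s])
      (simp_all add: mult.left_commute[of 3] flip: power_Suc)
  \<comment> \<open>The residue -1 of \<open>m\<close> modulo 9 is the residue 1 of
    \<open>- m\<close>, which is the case \<open>s = - 1\<close>.\<close>
  from this[of 1] this[of "- 1"]
  have "int_adjoin \<alpha> \<noteq> ring_of_integers K" if "[m = 1] (mod 9) \<or> [m = - 1] (mod 9)"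
    using that cong_minus_minus_iff[of m "- 1" 9] by auto
  moreover have "int_adjoin \<alpha> = ring_of_integers K"
    if m: "\<not> [m = 1] (mod 4)" "\<not> [m = 1] (mod 9)" "\<not> [m = - 1] (mod 9)"
    unfolding assms(8)
  proof (rule radical.ring_of_integers_eq_int_adjoin)
    fix p :: nat
    assume p: "Factorial_Ring.prime p" "p dvd 2 ^ u * 3 ^ v * nat \<bar>m\<bar>"
    show "radical.saturated_at p"
    proof (cases "int p dvd m")
      case True
      then show ?thesis using p(1) by (intro radical.saturated_at_prime_dvd)
    next
      case False
      \<comment> \<open>Apart from the divisors of \<open>m\<close> only 2 and 3 remain, and there
        the congruence conditions enter.\<close>
      then have "\<not> p dvd nat \<bar>m\<bar>" by (simp add: dvd_nat_abs_iff)
      then have "p dvd 2 ^ u \<or> p dvd 3 ^ v"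
        using p by (simp add: prime_dvd_mult_iff)
      then have "p dvd 2 \<or> p dvd 3"
        using p(1) prime_dvd_power by blast
      then consider "p = 2" | "p = 3"
        using p(1) primes_dvd_imp_eq[of p 2] primes_dvd_imp_eq[of p 3] by auto
      then show ?thesis
      proof cases
        case 1
        then have "odd m" using False by simp
        then obtain t where "m - m ^ 2 ^ u = 2 * t" "\<not> 2 dvd t"
          using minus_power_two_exponent_mod_4 m(1) assms(1) by metis
        then show ?thesis
          using 1 p(1) False by (intro radical.saturated_at_prime_dvd_degree[of p u "3 ^ v" t]) auto
      next
        case 2
        then have "\<not> 3 dvd m" using False by simp
        then obtain t where t: "m - m ^ 3 ^ v = 3 * t" "\<not> 3 dvd t"
          using minus_power_three_exponent_mod_9 m(2,3) assms(2) by metis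
        have "\<not> p dvd 2 ^ u" using 2 p(1) prime_dvd_power[of p 2 u] by auto
        then show ?thesis
          using 2 p(1) False t by (intro radical.saturated_at_prime_dvd_degree[of p v "2 ^ u" t]) auto
      qed
    qed
  qed
  ultimately show ?thesis
    using radical.F_lead_coeff radical.F_irreducible unfolding F by blast
qed

end
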